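(* Let $A$ be a $\mathbb{Z}$-graded vector space over a field of characteristic zero and let $\{m_n\}_{n \geq 1}$ be an $A_\infty$-structure on $A[1]$. Then there is an $A_\infty$-structure $\{t_k\}_{k \geq 1}$ on $T(A)[1]$, where $T(A) = \bigoplus_{n=1}^\infty A^{\otimes n}$ is the reduced tensor algebra, given on homogeneous elements by the following formulas (the symbol $\bigotimes$ separates the different inputs from $T(A)$): $$t_1(v_1 \otimes \dots \otimes v_n) = \sum_{i=1}^n \sum_{j=0}^{n-i} (-1)^{|v_1|+\dots+|v_j|}\, v_1 \otimes \dots \otimes v_j \otimes m_i(v_{j+1} \otimes \dots \otimes v_{j+i}) \otimes v_{j+i+1} \otimes \dots \otimes v_n,$$ $$t_2\Big(v_1 \otimes \dots \otimes v_n \bigotimes w_1 \otimes \dots \otimes w_m\Big) = \sum_{0 \le i < n,\ 0 \le j < m} (-1)^{|v_1|+\dots+|v_i|}\, v_1 \otimes \dots \otimes v_i \otimes m_{n+m-i-j}(v_{i+1} \otimes \dots \otimes v_n \otimes w_1 \otimes \dots \otimes w_{m-j}) \otimes w_{m-j+1} \otimes \dots \otimes w_m,$$ and for $k \geq 3$, with $N = n_1 + \dots + n_k$, $$t_k\Big(u_{11} \otimes \dots \otimes u_{1n_1} \bigotimes \dots \bigotimes u_{k1} \otimes \dots \otimes u_{kn_k}\Big) = \sum_{0 \le i < n_1,\ 0 \le j < n_k} (-1)^{|u_{11}|+\dots+|u_{1i}|}\, u_{11} \otimes \dots \otimes u_{1i} \otimes m_{N-i-j}(u_{1(i+1)} \otimes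 \dots \otimes u_{k(n_k-j)}) \otimes u_{k(n_k-j+1)} \otimes \dots \otimes u_{kn_k},$$ where the argument of $m_{N-i-j}$ consists of all the intermediate letters, in order, from $u_{1(i+1)}$ through $u_{k(n_k-j)}$.
   Context: For a $\mathbb{Z}$-graded vector space $V$, an $A_\infty$-structure on $V[1]$ is a collection $\{m_n\}_{n \geq 1}$ of degree $+1$ maps $m_n : V^{\otimes n} \to V$, where $m_1$ is the differential of $V$ (so $m_1^2 = 0$), such that for every $n \geq 1$ $$\sum_{n = i+j+k,\ k \geq 1,\ i,j \geq 0} m_{i+1+j}(id^{\otimes i} \otimes m_k \otimes id^{\otimes j}) = 0.$$ This is applied both to $V = A$ (with maps $m_n$) and to $V = T(A)$ (with maps $t_n$). Koszul sign rule: for homogeneous maps $f,g$ and homogeneous elements $x,y$, $(f \otimes g)(x \otimes y) = (-1)^{|g||x|} f(x) \otimes g(y)$. Degrees $|v|$ are those of $A$, and $T(A)$ carries the induced total grading $|v_1 \otimes \dots \otimes v_n| = |v_1| + \dots + |v_n|$. *)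

theory Defs
  imports Complex_Main "HOL-Library.Function_Algebras"
begin

section \<open>Graded vector spaces\<close>

text \<open>
  Vector spaces are linear subspaces \<open>V\<close> of an ambient type, so that the same notions
  apply to a given space and to the tensor algebra constructed from it.  The last assumption says
  that \<open>V\<close> is the internal direct sum of its homogeneous components \<open>G d\<close>.
\<close>

locale graded_vector_space = vector_space scale
  for scale :: "'k::field \<Rightarrow> 'v::ab_group_add \<Rightarrow> 'v" +
  fixes V :: "'v set" and G :: "int \<Rightarrow> 'v set"
  assumes subspace_carrier: "subspace V"
    and subspace_component: "subspace (G d)"
    and component_subset: "G d \<subseteq> V"
    and decomposition:
      "v \<in> V \<Longrightarrow> \<exists>!c. finite {d. c d \<noteq> 0} \<and> (\<forall>d. c d \<in> G d) \<and> (\<Sum>d | c d \<noteq> 0. c d) = v"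

definition homogeneous :: "(int \<Rightarrow> 'v set) \<Rightarrow> 'v list \<Rightarrow> int list \<Rightarrow> bool" where
  "homogeneous G vs ds \<longleftrightarrow> list_all2 (\<lambda>v d. v \<in> G d) vs ds"

definition multilinear_on ::
  "('k::field \<Rightarrow> 'v::ab_group_add \<Rightarrow> 'v) \<Rightarrow> 'v set \<Rightarrow>
   ('k \<Rightarrow> 'w::ab_group_add \<Rightarrow> 'w) \<Rightarrow> nat \<Rightarrow> ('v list \<Rightarrow> 'w) \<Rightarrow> bool" where
  "multilinear_on scale V scale' n f \<longleftrightarrow>
     (\<forall>vs i x y c. length vs = n \<and> set vs \<subseteq> V \<and> i < n \<and> x \<in> V \<and> y \<in> V \<longrightarrow>
        f (vs[i := x + y]) = f (vs[i := x]) + f (vs[i := y]) \<and>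
        f (vs[i := scale c x]) = scale' c (f (vs[i := x])))"


section \<open>\<open>A\<^sub>\<infinity>\<close>-structures\<close>

text \<open>The sign picked up when a map of degree 1 moves past homogeneous elements of degrees
  \<open>ds\<close>.\<close>

definition koszul :: "int list \<Rightarrow> 'k::field" where
  "koszul ds = (-1) powi sum_list ds"

text \<open>
  A linear map on the \<open>n\<close>-th tensor power of \<open>V\<close> is given as an \<open>n\<close>-linear map on lists of
  length \<open>n\<close>.  The relation is
  \<open>\<Sum>\<^bsub>i+k+j=n\<^esub> m\<^bsub>i+1+j\<^esub> (id\<^sup>i \<otimes> m\<^sub>k \<otimes> id\<^sup>j) = 0\<close>, evaluated on homogeneous elements
  with the Koszul sign rule.  The degrees are those of \<open>V\<close>, not of its shift, and every
  \<open>m\<^sub>n\<close> has degree 1 with respect to them.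
\<close>

locale A_infinity = graded_vector_space scale V G
  for scale :: "'k::field \<Rightarrow> 'v::ab_group_add \<Rightarrow> 'v"
    and V :: "'v set" and G :: "int \<Rightarrow> 'v set" +
  fixes m :: "nat \<Rightarrow> 'v list \<Rightarrow> 'v"
  assumes op_closed: "n \<ge> 1 \<Longrightarrow> length vs = n \<Longrightarrow> set vs \<subseteq> V \<Longrightarrow> m n vs \<in> V"
    and op_multilinear: "n \<ge> 1 \<Longrightarrow> multilinear_on scale V scale n (m n)"
    and op_degree:
      "n \<ge> 1 \<Longrightarrow> length vs = n \<Longrightarrow> homogeneous G vs ds \<Longrightarrow> m n vs \<in> G (sum_list ds + 1)"
    and A_infinity_relation:
      "n \<ge> 1 \<Longrightarrow> length vs = n \<Longrightarrow> homogeneous G vs ds \<Longrightarrow>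
       (\<Sum>(i, k, j) \<in> {(i, k, j). i + k + j = n \<and> k \<ge> 1}.
          scale (koszul (take i ds))
            (m (i + 1 + j) (take i vs @ [m k (take k (drop i vs))] @ drop (i + k) vs))) = 0"


section \<open>The reduced tensor algebra\<close>

text \<open>
  Over a field, the tensor powers of \<open>V\<close> embed into the duals of the spaces of multilinear forms
  on \<open>V\<close>: the pure tensor \<open>v\<^sub>1 \<otimes> \<dots> \<otimes> v\<^sub>n\<close> is the functional that evaluates a form at
  \<open>(v\<^sub>1, \<dots>, v\<^sub>n)\<close>.  A form is here a family with one \<open>n\<close>-linear form for every \<open>n \<ge> 1\<close>,
  encoded as one function on lists, so that the different tensor powers are linearly independent
  of each other.  Lemma \<open>tensor_algebra_universal\<close> below proves the universal property of
  this model: families of multilinear maps on \<open>V\<close> extend uniquely to linear maps.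
\<close>

definition multilinear_form ::
  "('k::field \<Rightarrow> 'v::ab_group_add \<Rightarrow> 'v) \<Rightarrow> 'v set \<Rightarrow> ('v list \<Rightarrow> 'k) \<Rightarrow> bool" where
  "multilinear_form scale V \<phi> \<longleftrightarrow> (\<forall>n\<ge>1. multilinear_on scale V (*) n \<phi>)"

type_synonym ('v, 'k) tensor = "('v list \<Rightarrow> 'k) \<Rightarrow> 'k"

definition tensor_scale :: "'k::field \<Rightarrow> ('v, 'k) tensor \<Rightarrow> ('v, 'k) tensor" where
  "tensor_scale c T = (\<lambda>\<phi>. c * T \<phi>)"

definition pure_tensor ::
  "('k::field \<Rightarrow> 'v::ab_group_add \<Rightarrow> 'v) \<Rightarrow> 'v set \<Rightarrow> 'v list \<Rightarrow> ('v, 'k) tensor" where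
  "pure_tensor scale V vs = (\<lambda>\<phi>. if multilinear_form scale V \<phi> then \<phi> vs else 0)"

global_interpretation tensor: vector_space "tensor_scale :: 'k::field \<Rightarrow> ('v, 'k) tensor \<Rightarrow> _"
  by unfold_locales (auto simp: tensor_scale_def fun_eq_iff algebra_simps)

definition tensor_power ::
  "('k::field \<Rightarrow> 'v::ab_group_add \<Rightarrow> 'v) \<Rightarrow> 'v set \<Rightarrow> nat \<Rightarrow> ('v, 'k) tensor set" where
  "tensor_power scale V n = tensor.span {pure_tensor scale V vs | vs. length vs = n \<and> set vs \<subseteq> V}"

definition tensor_algebra ::
  "('k::field \<Rightarrow> 'v::ab_group_add \<Rightarrow> 'v) \<Rightarrow> 'v set \<Rightarrow> ('v, 'k) tensor set" where
  "tensor_algebra scale V = tensor.span (\<Union>n\<in>{1..}. tensor_power scale V n)"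

definition tensor_component ::
  "('k::field \<Rightarrow> 'v::ab_group_add \<Rightarrow> 'v) \<Rightarrow> 'v set \<Rightarrow> (int \<Rightarrow> 'v set) \<Rightarrow> int \<Rightarrow> ('v, 'k) tensor set" where
  "tensor_component scale V G d =
     tensor.span {pure_tensor scale V vs | vs ds. vs \<noteq> [] \<and> homogeneous G vs ds \<and> sum_list ds = d}"

lemma tensor_algebra_eq_span:
  "tensor_algebra scale V = tensor.span {pure_tensor scale V vs | vs. vs \<noteq> [] \<and> set vs \<subseteq> V}"
    (is "_ = tensor.span ?S")
proof
  have "tensor_power scale V n \<subseteq> tensor.span ?S" if "n \<ge> 1" for n
    unfolding tensor_power_def using that by (intro tensor.span_mono) auto
  then show "tensor_algebra scale V \<subseteq> tensor.span ?S"
    unfolding tensor_algebra_def by (intro tensor.span_minimal) auto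
  have "?S \<subseteq> (\<Union>n\<in>{1..}. tensor_power scale V n)"
  proof
    fix x assume "x \<in> ?S"
    then obtain vs where vs: "x = pure_tensor scale V vs" "vs \<noteq> []" "set vs \<subseteq> V" by auto
    then have "x \<in> tensor_power scale V (length vs)"
      unfolding tensor_power_def by (intro tensor.span_base) auto
    moreover have "length vs \<in> {1..}" using vs by (cases vs) auto
    ultimately show "x \<in> (\<Union>n\<in>{1..}. tensor_power scale V n)" by blast
  qed
  then show "tensor.span ?S \<subseteq> tensor_algebra scale V"
    unfolding tensor_algebra_def by (rule tensor.span_mono)
qed

lemma pure_tensor_multilinear:
  assumes "n \<ge> 1"
  shows "multilinear_on scale V tensor_scale n (pure_tensor scale V)"
  unfolding multilinear_on_def
proof (intro allI impI, elim conjE)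
  fix vs i x y and c :: 'a
  assume a: "length vs = n" "set vs \<subseteq> V" "i < n" "x \<in> V" "y \<in> V"
  have "\<phi> (vs[i := x + y]) = \<phi> (vs[i := x]) + \<phi> (vs[i := y]) \<and>
      \<phi> (vs[i := scale c x]) = c * \<phi> (vs[i := x])" if "multilinear_form scale V \<phi>" for \<phi>
    using that assms a unfolding multilinear_form_def multilinear_on_def by blast
  then show "pure_tensor scale V (vs[i := x + y]) =
      pure_tensor scale V (vs[i := x]) + pure_tensor scale V (vs[i := y]) \<and>
    pure_tensor scale V (vs[i := scale c x]) = tensor_scale c (pure_tensor scale V (vs[i := x]))"
    by (simp add: pure_tensor_def tensor_scale_def fun_eq_iff)
qed

lemma exists_functional:
  fixes scale :: "'k::field \<Rightarrow> 'w::ab_group_add \<Rightarrow> 'w"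
  assumes W: "vector_space scale" and "w \<noteq> 0"
  obtains h where "Vector_Spaces.linear scale (*) h" "h w = 1"
proof -
  have "vector_space ((*) :: 'k \<Rightarrow> 'k \<Rightarrow> 'k)"
    by unfold_locales (auto simp: algebra_simps)
  with W have pair: "vector_space_pair scale ((*) :: 'k \<Rightarrow> 'k \<Rightarrow> 'k)"
    by (rule vector_space_pair.intro)
  have "\<not> module.dependent scale {w}"
    using W \<open>w \<noteq> 0\<close> by (simp add: vector_space.dependent_single)
  from vector_space_pair.linear_independent_extend[OF pair this, of "\<lambda>_. 1"]
  show ?thesis using that by auto
qed

lemma tensor_algebra_universal:
  fixes scale :: "'k::field \<Rightarrow> 'v::ab_group_add \<Rightarrow> 'v"
    and scale' :: "'k \<Rightarrow> 'w::ab_group_add \<Rightarrow> 'w"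
  assumes W: "vector_space scale'"
    and f: "\<And>n. n \<ge> 1 \<Longrightarrow> multilinear_on scale V scale' n f"
  shows "\<exists>g. Vector_Spaces.linear tensor_scale scale' g \<and>
      (\<forall>vs. vs \<noteq> [] \<and> set vs \<subseteq> V \<longrightarrow> g (pure_tensor scale V vs) = f vs) \<and>
      (\<forall>g'. Vector_Spaces.linear tensor_scale scale' g' \<and>
        (\<forall>vs. vs \<noteq> [] \<and> set vs \<subseteq> V \<longrightarrow> g' (pure_tensor scale V vs) = f vs) \<longrightarrow>
        (\<forall>x\<in>tensor_algebra scale V. g' x = g x))"
proof -
  let ?t = "pure_tensor scale V"
  let ?L = "{vs. vs \<noteq> [] \<and> set vs \<subseteq> V}"
  interpret W: vector_space scale' by (rule W)
  interpret TW: vector_space_pair "tensor_scale :: 'k \<Rightarrow> ('v, 'k) tensor \<Rightarrow> _" scale' ..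
  obtain B where B: "B \<subseteq> ?t ` ?L" "tensor.independent B" "?t ` ?L \<subseteq> tensor.span B"
    by (rule tensor.maximal_independent_subset)
  define r where "r b = (SOME vs. vs \<in> ?L \<and> ?t vs = b)" for b
  have r: "r b \<in> ?L \<and> ?t (r b) = b" if "b \<in> B" for b
    unfolding r_def by (rule someI_ex) (use B(1) that in blast)
  obtain g where g: "Vector_Spaces.linear tensor_scale scale' g" "\<And>b. b \<in> B \<Longrightarrow> g b = f (r b)"
    using TW.linear_independent_extend[OF B(2), of "\<lambda>b. f (r b)"] by blast
  have gf: "g (?t vs) = f vs" if vs: "vs \<in> ?L" for vs
  proof (rule ccontr)
    define w where "w = g (?t vs) - f vs"
    assume "g (?t vs) \<noteq> f vs"
    then have "w \<noteq> 0" by (simp add: w_def)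
    then obtain h where h: "Vector_Spaces.linear scale' (*) h" "h w = 1"
      using exists_functional[OF W] by blast
    have h_add: "h (x + y) = h x + h y" and h_scale: "h (scale' c x) = c * h x" for x y c
      using h(1) by (simp_all add: Vector_Spaces.linear_iff)
    have h_diff: "h (x - y) = h x - h y" for x y
      using h_add[of "x - y" y] by simp
    have h_0: "h 0 = 0"
      using h_diff[of 0 0] by simp
    interpret g: Vector_Spaces.linear tensor_scale scale' g by (rule g)
    have form: "multilinear_form scale V (h \<circ> f)"
      unfolding multilinear_form_def multilinear_on_def
    proof (intro allI impI, elim conjE)
      fix n vs i x y c
      assume a: "n \<ge> 1" "length vs = n" "set vs \<subseteq> V" "i < n" "x \<in> V" "y \<in> V"
      have "f (vs[i := x + y]) = f (vs[i := x]) + f (vs[i := y]) \<and>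
          f (vs[i := scale c x]) = scale' c (f (vs[i := x]))"
        using f[OF a(1)] a unfolding multilinear_on_def by blast
      then show "(h \<circ> f) (vs[i := x + y]) = (h \<circ> f) (vs[i := x]) + (h \<circ> f) (vs[i := y]) \<and>
          (h \<circ> f) (vs[i := scale c x]) = c * (h \<circ> f) (vs[i := x])"
        by (simp add: h_add h_scale)
    qed
    have "?t vs \<in> tensor.span B" using B(3) vs by blast
    then obtain F c where F: "finite F" "F \<subseteq> B" "?t vs = (\<Sum>b\<in>F. tensor_scale (c b) b)"
      unfolding tensor.span_explicit by blast
    have sum_app: "sum T F (h \<circ> f) = (\<Sum>b\<in>F. T b (h \<circ> f))" for T :: "('v, 'k) tensor \<Rightarrow> ('v, 'k) tensor"
      using F(1) by (induction F rule: finite_induct) auto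
    have "h (f vs) = ?t vs (h \<circ> f)"
      using form by (simp add: pure_tensor_def)
    also have "\<dots> = (\<Sum>b\<in>F. c b * b (h \<circ> f))"
      unfolding F(3) sum_app by (simp add: tensor_scale_def)
    also have "\<dots> = (\<Sum>b\<in>F. c b * h (g b))"
    proof (rule sum.cong[OF refl])
      fix b assume "b \<in> F"
      then have b: "b \<in> B" using F by auto
      have "b (h \<circ> f) = ?t (r b) (h \<circ> f)" using r[OF b] by simp
      also have "\<dots> = h (g b)" using form g(2)[OF b] by (simp add: pure_tensor_def)
      finally show "c b * b (h \<circ> f) = c b * h (g b)" by simp
    qed
    also have "\<dots> = h (g (?t vs))"
    proof -
      have "h (\<Sum>b\<in>F. u b) = (\<Sum>b\<in>F. h (u b))" for u
        using F(1) by (induction F rule: finite_induct) (simp_all add: h_0 h_add)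
      then show ?thesis
        unfolding F(3) by (simp add: g.sum g.scale h_scale)
    qed
    finally have "h w = 0" by (simp add: w_def h_diff)
    then show False using h(2) by simp
  qed
  have "g' x = g x"
    if g': "Vector_Spaces.linear tensor_scale scale' g'"
      "\<forall>vs. vs \<noteq> [] \<and> set vs \<subseteq> V \<longrightarrow> g' (?t vs) = f vs"
      and x: "x \<in> tensor_algebra scale V" for g' x
  proof (rule TW.linear_eq_on[OF g'(1) g(1) x[unfolded tensor_algebra_eq_span]])
    fix b assume "b \<in> {?t vs | vs. vs \<noteq> [] \<and> set vs \<subseteq> V}"
    then obtain vs where "b = ?t vs" "vs \<noteq> []" "set vs \<subseteq> V" by blast
    then show "g' b = g b" using g'(2) gf by simp
  qed
  with g(1) gf show ?thesis by blast
qed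

end

theory Submission
  imports Defs
begin

text \<open>
  All operations have one description.  Concatenate the input words
  \<open>u\<^sub>1, \<dots>, u\<^sub>k\<close> to one word, choose a nonempty interval of it that starts in
  \<open>u\<^sub>1\<close> and ends in \<open>u\<^sub>k\<close>, and replace the letters of the interval by the value of the
  operation of \<open>A\<close> on them, with the sign of the degrees to the left of the interval; \<open>t\<^sub>k\<close>
  is the sum over all such intervals.  For \<open>k = 1\<close> these are all nonempty intervals.

  In a summand of the relation for \<open>u\<^sub>1, \<dots>, u\<^sub>n\<close>, the inner operation picks an
  interval \<open>I\<close>, which may be an arbitrary nonempty interval of the concatenation: its end points
  determine the consecutive words that the inner operation is applied to, and these merge to one
  word.  The outer operation picks an interval \<open>J\<close> of the new word.  There are two kinds of pairs.

  \<^item> \<open>J\<close> contains the letter produced from \<open>I\<close>.  Then \<open>J\<close> comes from an interval \<open>K\<close> of the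
    original word that contains \<open>I\<close>, starts in \<open>u\<^sub>1\<close> and ends in \<open>u\<^sub>n\<close>.  For fixed \<open>K\<close>,
    every \<open>I\<close> inside \<open>K\<close> occurs once, and the sum vanishes by the relation of \<open>A\<close> for the
    letters of \<open>K\<close> (\<open>double_op_nested\<close>).
  \<^item> \<open>J\<close> does not contain it.  Since \<open>J\<close> reaches from the first to the last of the remaining
    words, this forces the left one of the two intervals to start in \<open>u\<^sub>1\<close>, the right one to end in
    \<open>u\<^sub>n\<close>, and the end of the left one to lie in the same word as the start of the right one.
    This condition does not mention which of the two was chosen first, so both orders occur;
    they give the same word with opposite signs, because the operation applied first raises the
    degree to the left of the other one only if it is the left one (\<open>double_op_disjoint\<close>).

  The bookkeeping of end points and words is purely combinatorial and is isolated in
  \<open>sum_pairs_of_intervals_eq_0\<close>.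

  It remains to see that the operations exist on \<open>T(A)\<close> and not just on words.  The sign becomes
  linear in the letters when it is expressed by the operator that acts by \<open>(-1)\<^sup>d\<close> in degree \<open>d\<close>.
  A map that is multilinear in the letters of each of \<open>k\<close> words then extends to tensors by
  evaluating the tensors one after the other (\<open>extend\<close>), as tensors are functionals on multilinear
  forms.  All axioms are multilinear statements, so they follow from pure tensors of homogeneous
  letters by \<open>multilinear_on_span\<close>.  Finally, \<open>T(A)\<close> is the direct sum of its components because
  these are eigenspaces, with different eigenvalues \<open>2\<^sup>d\<close>, of the operator induced by the one
  that acts by \<open>2\<^sup>d\<close> on the letters of degree \<open>d\<close>.
\<close>

section \<open>Multilinear maps\<close>

context vector_space
begin

lemma multilinear_onI:
  assumes W: "vector_space scale'" and V: "subspace V"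
    and lin: "\<And>vs i x y c. length vs = n \<Longrightarrow> set vs \<subseteq> V \<Longrightarrow> i < n \<Longrightarrow> x \<in> V \<Longrightarrow> y \<in> V \<Longrightarrow>
      f (vs[i := x + scale c y]) = f (vs[i := x]) + scale' c (f (vs[i := y]))"
  shows "multilinear_on scale V scale' n f"
  unfolding multilinear_on_def
proof (intro allI impI, elim conjE)
  fix vs i x y c
  assume a: "length vs = n" "set vs \<subseteq> V" "i < n" "x \<in> V" "y \<in> V"
  interpret W: vector_space scale' by (rule W)
  have 0: "0 \<in> V" using V by (rule subspace_0)
  have "f (vs[i := 0]) = f (vs[i := 0]) + f (vs[i := 0])"
    using lin[OF a(1-3) 0 0, of 1] by simp
  then have "f (vs[i := 0]) = 0" by simp
  then show "f (vs[i := x + y]) = f (vs[i := x]) + f (vs[i := y]) \<and>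
      f (vs[i := scale c x]) = scale' c (f (vs[i := x]))"
    using lin[OF a, of 1] lin[OF a(1-3) 0 a(4), of c] by simp
qed

lemma multilinear_on_lincomb:
  assumes "multilinear_on scale V scale' n f" "subspace V"
    and "length vs = n" "set vs \<subseteq> V" "i < n" "x \<in> V" "y \<in> V"
  shows "f (vs[i := x + scale c y]) = f (vs[i := x]) + scale' c (f (vs[i := y]))"
proof -
  have "scale c y \<in> V" using assms by (simp add: subspace_scale)
  then show ?thesis using assms unfolding multilinear_on_def by metis
qed

lemma multilinear_on_lincomb_sum:
  assumes f: "multilinear_on scale V scale' n f" and V: "subspace V" and W: "vector_space scale'"
    and len: "length ps + 1 + length qs = n" and sub: "set ps \<subseteq> V" "set qs \<subseteq> V"
    and y: "\<And>l. l \<in> I \<Longrightarrow> y l \<in> V" and fin: "finite I"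
  shows "f (ps @ [\<Sum>l\<in>I. scale (c l) (y l)] @ qs) = (\<Sum>l\<in>I. scale' (c l) (f (ps @ [y l] @ qs)))"
proof -
  interpret W: vector_space scale' by (rule W)
  have 0: "0 \<in> V" using V by (rule subspace_0)
  have lin: "f (ps @ [x + scale a z] @ qs) = f (ps @ [x] @ qs) + scale' a (f (ps @ [z] @ qs))"
    if "x \<in> V" "z \<in> V" for x z a
    using multilinear_on_lincomb[OF f V, of "ps @ [0] @ qs" "length ps" x z a] that len sub 0
    by (simp add: list_update_append)
  from fin y show ?thesis
  proof (induction I rule: finite_induct)
    case empty
    show ?case using lin[OF 0 0, of 1] by simp
  next
    case (insert l I)
    have "(\<Sum>l\<in>I. scale (c l) (y l)) \<in> V"
      using V insert by (intro subspace_sum subspace_scale) auto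
    then show ?case
      using lin[of "\<Sum>l\<in>I. scale (c l) (y l)" "y l" "c l"] insert by (simp add: add.commute)
  qed
qed

text \<open>
  The summands of both \<open>A\<^sub>\<infinity>\<close>-relations and of the operations on words have this shape: a
  multilinear map is applied to a consecutive part of the arguments, and another one to the result
  and the remaining arguments.
\<close>

lemma multilinear_on_insert:
  assumes f: "multilinear_on scale V scale' (i + 1 + j) f" and g: "multilinear_on scale V scale k g"
    and closed: "\<And>vs. length vs = k \<Longrightarrow> set vs \<subseteq> V \<Longrightarrow> g vs \<in> V"
    and V: "subspace V" and W: "vector_space scale'"
  shows "multilinear_on scale V scale' (i + k + j)
    (\<lambda>vs. f (take i vs @ [g (take k (drop i vs))] @ drop (i + k) vs))"
proof (rule multilinear_onI[OF W V])
  fix vs l x y c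
  assume a: "length vs = i + k + j" "set vs \<subseteq> V" "l < i + k + j" "x \<in> V" "y \<in> V"
  let ?p = "take i vs" and ?q = "take k (drop i vs)" and ?s = "drop (i + k) vs"
  have sub: "set ?p \<subseteq> V" "set ?q \<subseteq> V" "set ?s \<subseteq> V"
    using a(2) by (meson order_trans set_drop_subset set_take_subset)+
  have len: "length ?p = i" "length ?q = k" "length ?s = j" using a by auto
  note f = multilinear_on_lincomb[OF f V]
  let ?ins = "\<lambda>vs. take i vs @ [g (take k (drop i vs))] @ drop (i + k) vs"
  have lI: "l < length vs" using a by simp
  consider "l < i" | "i \<le> l" "l < i + k" | "i + k \<le> l" by linarith
  then show "f (?ins (vs[l := x + scale c y])) = f (?ins (vs[l := x])) + scale' c (f (?ins (vs[l := y])))"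
  proof cases
    case 1
    have "?ins (vs[l := z]) = (?ins vs)[l := z]" for z
      using 1 lI by (simp add: take_update_swap drop_update_cancel list_update_append)
    moreover have "f ((?ins vs)[l := x + scale c y]) =
        f ((?ins vs)[l := x]) + scale' c (f ((?ins vs)[l := y]))"
      by (rule f) (use a sub len closed 1 in auto)
    ultimately show ?thesis by simp
  next
    case 2
    have upd: "?ins (vs[l := z]) = (?p @ [0] @ ?s)[i := g (?q[l - i := z])]" for z
      using 2 len(1) take_update_swap[of k "drop i vs" "l - i" z]
      by (simp add: drop_update_swap list_update_append)
    have g': "g (?q[l - i := x + scale c y]) = g (?q[l - i := x]) + scale c (g (?q[l - i := y]))"
      by (rule multilinear_on_lincomb[OF g V]) (use a sub len 2 in auto)
    have "f ((?p @ [0] @ ?s)[i := g (?q[l - i := x]) + scale c (g (?q[l - i := y]))]) =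
        f ((?p @ [0] @ ?s)[i := g (?q[l - i := x])]) + scale' c (f ((?p @ [0] @ ?s)[i := g (?q[l - i := y])]))"
    proof (rule f)
      show "set (?p @ [0] @ ?s) \<subseteq> V" using sub subspace_0[OF V] by auto
      have "set (?q[l - i := z]) \<subseteq> V" if "z \<in> V" for z
        using set_update_subsetI[OF sub(2) that] .
      then show "g (?q[l - i := x]) \<in> V" "g (?q[l - i := y]) \<in> V"
        using len(2) a by (auto intro!: closed)
    qed (use len in auto)
    then show ?thesis unfolding upd g' .
  next
    case 3
    have "?ins (vs[l := z]) = (?ins vs)[l - k + 1 := z]" for z
    proof -
      have "l - k + 1 - i = Suc (l - (i + k))" "\<not> l - k + 1 < i" using 3 by auto
      moreover have "min (length vs) i = i" "take k ((drop i vs)[l - i := z]) = take k (drop i vs)"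
        using 3 lI by auto
      ultimately show ?thesis
        using 3 lI by (simp add: drop_update_swap list_update_append)
    qed
    moreover have "f ((?ins vs)[l - k + 1 := x + scale c y]) =
        f ((?ins vs)[l - k + 1 := x]) + scale' c (f ((?ins vs)[l - k + 1 := y]))"
      by (rule f) (use a sub len closed 3 in auto)
    ultimately show ?thesis by simp
  qed
qed

lemma multilinear_on_sum:
  assumes W: "vector_space scale'" and V: "subspace V"
    and f: "\<And>x. x \<in> I \<Longrightarrow> multilinear_on scale V scale' n (f x)"
  shows "multilinear_on scale V scale' n (\<lambda>vs. \<Sum>x\<in>I. scale' (c x) (f x vs))"
proof (rule multilinear_onI[OF W V])
  interpret W: vector_space scale' by (rule W)
  fix vs i x y a
  assume a: "length vs = n" "set vs \<subseteq> V" "i < n" "x \<in> V" "y \<in> V"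
  have "(\<Sum>z\<in>I. scale' (c z) (f z (vs[i := x + scale a y]))) =
      (\<Sum>z\<in>I. scale' (c z) (f z (vs[i := x])) + scale' a (scale' (c z) (f z (vs[i := y]))))"
    by (rule sum.cong[OF refl])
      (simp add: multilinear_on_lincomb[OF f V a] W.scale_right_distrib W.scale_left_commute)
  then show "(\<Sum>z\<in>I. scale' (c z) (f z (vs[i := x + scale a y]))) =
      (\<Sum>z\<in>I. scale' (c z) (f z (vs[i := x]))) + scale' a (\<Sum>z\<in>I. scale' (c z) (f z (vs[i := y])))"
    by (simp add: sum.distrib W.scale_sum_right)
qed

text \<open>
  The principle that reduces every axiom to pure tensors.  Each argument has its own spanning set,
  so that arguments of prescribed degrees can be treated as well.  The arguments are replaced by
  elements of the spanning sets one at a time, from the left.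
\<close>

lemma multilinear_on_span:
  assumes f: "multilinear_on scale V scale' n f" and V: "subspace V"
    and W: "vector_space scale'" "module.subspace scale' W"
    and Ss: "length Ss = n" "\<And>S. S \<in> set Ss \<Longrightarrow> S \<subseteq> V"
    and base: "\<And>us. list_all2 (\<in>) us Ss \<Longrightarrow> f us \<in> W"
    and xs: "list_all2 (\<lambda>x S. x \<in> span S) xs Ss"
  shows "f xs \<in> W"
proof -
  interpret W: vector_space scale' by (rule W)
  \<comment> \<open>the first \<open>l\<close> arguments are arbitrary, the others belong to the spanning sets\<close>
  have "f ys \<in> W" if "l \<le> n" "length ys = n" "\<And>q. q < l \<Longrightarrow> ys ! q \<in> span (Ss ! q)"
    "\<And>q. l \<le> q \<Longrightarrow> q < n \<Longrightarrow> ys ! q \<in> Ss ! q" for l ys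
    using that
  proof (induction l arbitrary: ys)
    case 0
    then show ?case using Ss by (intro base) (simp add: list_all2_conv_all_nth)
  next
    case (Suc l)
    let ?S = "Ss ! l"
    have SV: "Ss ! q \<subseteq> V" if "q < n" for q using that Ss by simp
    have spV: "span (Ss ! q) \<subseteq> V" if "q < n" for q using SV[OF that] V by (rule span_minimal)
    have "ys ! q \<in> V" if "q < n" for q
      using Suc.prems(1,3,4) SV spV that by (metis Suc_leI not_less subsetD)
    then have ysV: "set ys \<subseteq> V" using Suc.prems(2) by (auto simp: in_set_conv_nth)
    have l: "l < n" using Suc.prems by simp
    have lin: "f (ys[l := x + scale c y]) = f (ys[l := x]) + scale' c (f (ys[l := y]))"
      if "x \<in> V" "y \<in> V" for x y c
      using multilinear_on_lincomb[OF f V Suc.prems(2) ysV l that] .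
    have 0: "0 \<in> V" using V by (rule subspace_0)
    have f0: "f (ys[l := 0]) = 0" using lin[OF 0 0, of 1] by simp
    define P where "P x \<longleftrightarrow> x \<in> V \<and> f (ys[l := x]) \<in> W" for x
    have P0: "P 0" unfolding P_def using 0 f0 W.subspace_0[OF W(2)] by simp
    have "P (ys ! l)"
    proof (rule span_induct_alt[of _ ?S])
      show "ys ! l \<in> span ?S" using Suc.prems by simp
      show "P 0" by (rule P0)
    next
      fix c x y assume x: "x \<in> ?S" and y: "P y"
      have xV: "x \<in> V" using x SV l by auto
      have "f (ys[l := x]) \<in> W"
      proof (rule Suc.IH)
        show "ys[l := x] ! q \<in> span (Ss ! q)" if "q < l" for q
          using that Suc.prems by simp
        show "ys[l := x] ! q \<in> Ss ! q" if "l \<le> q" "q < n" for q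
          using that Suc.prems x by (cases "q = l") auto
      qed (use Suc.prems in auto)
      moreover have "y \<in> V" "f (ys[l := y]) \<in> W" using y by (auto simp: P_def)
      ultimately show "P (scale c x + y)"
        unfolding P_def using lin[of y x c] xV V W(2)
        by (simp add: add.commute subspace_add subspace_scale W.subspace_add W.subspace_scale)
    qed
    then show ?case by (simp add: P_def)
  qed
  from this[of n xs] show ?thesis using xs Ss by (simp add: list_all2_conv_all_nth)
qed

end

section \<open>Gradings\<close>

context vector_space
begin

lemma finite_sum_if_in_span_UN:
  assumes C: "\<And>d. subspace (C d)" and x: "x \<in> span (\<Union>d. C d)"
  obtains c D where "finite D" "\<And>d. c d \<in> C d" "\<And>d. d \<notin> D \<Longrightarrow> c d = 0" "(\<Sum>d\<in>D. c d) = x"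
proof -
  have "\<exists>c D. finite D \<and> (\<forall>d. c d \<in> C d) \<and> (\<forall>d. d \<notin> D \<longrightarrow> c d = 0) \<and> (\<Sum>d\<in>D. c d) = x"
    using x
  proof (induction rule: span_induct_alt)
    case base
    show ?case using C by (intro exI[of _ "\<lambda>_. 0"] exI[of _ "{}"]) (auto simp: subspace_0)
  next
    case (step a x y)
    then obtain c D where cD: "finite D" "\<forall>d. c d \<in> C d" "\<forall>d. d \<notin> D \<longrightarrow> c d = 0" "(\<Sum>d\<in>D. c d) = y"
      by blast
    from step obtain e where e: "x \<in> C e" by blast
    define c' where "c' d = (if d = e then scale a x else 0) + c d" for d
    have "(\<Sum>d\<in>insert e D. c' d) = scale a x + (\<Sum>d\<in>insert e D. c d)"
      using cD(1) by (simp add: c'_def sum.distrib)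
    also have "(\<Sum>d\<in>insert e D. c d) = y"
      using cD by (simp add: sum.insert_if)
    finally have "(\<Sum>d\<in>insert e D. c' d) = scale a x + y" .
    moreover have "c' d \<in> C d" for d
      using e cD C by (auto simp: c'_def subspace_add subspace_scale)
    moreover have "c' d = 0" if "d \<notin> insert e D" for d
      using that cD by (simp add: c'_def)
    ultimately show ?case
      using cD(1) by (intro exI[of _ c'] exI[of _ "insert e D"]) auto
  qed
  then show ?thesis using that by blast
qed

text \<open>
  Applying \<open>S - lam e\<close> to the sum removes the summand \<open>c e\<close> and multiplies each other one by a
  nonzero scalar.
\<close>

lemma eigenvectors_sum_eq_0:
  assumes S: "Vector_Spaces.linear scale scale S"
    and "finite D" "inj_on lam D" "\<And>d. d \<in> D \<Longrightarrow> S (c d) = scale (lam d) (c d)"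
    and "(\<Sum>d\<in>D. c d) = 0" "d \<in> D"
  shows "c d = 0"
  using assms(2-)
proof (induction D arbitrary: c d rule: finite_induct)
  case empty
  then show ?case by simp
next
  case (insert e D)
  interpret S: Vector_Spaces.linear scale scale S by (rule S)
  have "(\<Sum>d\<in>insert e D. scale (lam d) (c d)) = S (\<Sum>d\<in>insert e D. c d)"
    unfolding S.sum by (rule sum.cong) (auto simp: insert.prems(2))
  then have "(\<Sum>d\<in>insert e D. scale (lam d) (c d)) - scale (lam e) (\<Sum>d\<in>insert e D. c d) = 0"
    unfolding insert.prems(3) by simp
  then have *: "(\<Sum>d\<in>D. scale (lam d - lam e) (c d)) = 0"
    using insert.hyps by (simp add: scale_left_diff_distrib scale_right_distrib sum_subtractf scale_sum_right)
  have D0: "c d = 0" if d: "d \<in> D" for d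
  proof -
    have "scale (lam d - lam e) (c d) = 0"
    proof (rule insert.IH[OF _ _ * d])
      show "inj_on lam D" using insert.prems(1) by simp
      show "S (scale (lam x - lam e) (c x)) = scale (lam x) (scale (lam x - lam e) (c x))" if "x \<in> D" for x
        using insert.prems(2)[of x] that by (simp add: S.scale mult.commute)
    qed
    moreover have "lam d \<noteq> lam e" using insert.prems(1) insert.hyps d by (auto simp: inj_on_def)
    ultimately show ?thesis by simp
  qed
  then show ?case using insert.prems(3,4) insert.hyps by auto
qed

end

context graded_vector_space
begin

definition homogeneous_part :: "'v \<Rightarrow> int \<Rightarrow> 'v" where
  "homogeneous_part v = (THE c. finite {d. c d \<noteq> 0} \<and> (\<forall>d. c d \<in> G d) \<and> (\<Sum>d | c d \<noteq> 0. c d) = v)"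

lemma homogeneous_part:
  assumes "v \<in> V"
  shows "finite {d. homogeneous_part v d \<noteq> 0}" "homogeneous_part v d \<in> G d" "(\<Sum>d | homogeneous_part v d \<noteq> 0. homogeneous_part v d) = v"
  using theI'[OF decomposition[OF assms], folded homogeneous_part_def] by auto

lemma homogeneous_part_eqI:
  assumes v: "v \<in> V" and "finite D" "\<And>d. c d \<in> G d" "\<And>d. d \<notin> D \<Longrightarrow> c d = 0" "(\<Sum>d\<in>D. c d) = v"
  shows "homogeneous_part v = c"
proof -
  have sub: "{d. c d \<noteq> 0} \<subseteq> D" using assms by auto
  then have "(\<Sum>d | c d \<noteq> 0. c d) = v"
    using assms by (subst assms(5)[symmetric], intro sum.mono_neutral_left) auto
  moreover have "finite {d. c d \<noteq> 0}" using sub assms(2) by (rule finite_subset)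
  ultimately have "finite {d. c d \<noteq> 0} \<and> (\<forall>d. c d \<in> G d) \<and> (\<Sum>d | c d \<noteq> 0. c d) = v"
    using assms(3) by blast
  then show ?thesis unfolding homogeneous_part_def by (rule the1_equality[OF decomposition[OF v]])
qed

text \<open>
  The linear operator that acts by \<open>q\<^sup>d\<close> in degree \<open>d\<close>.  The choice \<open>q = - 1\<close> produces the
  Koszul signs; a \<open>q\<close> with pairwise different powers separates the degrees.
\<close>

definition weight :: "'k \<Rightarrow> 'v \<Rightarrow> 'v" where
  "weight q v = (\<Sum>d | homogeneous_part v d \<noteq> 0. scale (q powi d) (homogeneous_part v d))"

lemma weight_eq_sum:
  assumes "finite D" "\<And>d. d \<notin> D \<Longrightarrow> homogeneous_part v d = 0"
  shows "weight q v = (\<Sum>d\<in>D. scale (q powi d) (homogeneous_part v d))"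
  unfolding weight_def using assms by (intro sum.mono_neutral_left) auto

lemma weight_lincomb:
  assumes x: "x \<in> V" and y: "y \<in> V"
  shows "weight q (x + scale c y) = weight q x + scale c (weight q y)"
proof -
  let ?D = "{d. homogeneous_part x d \<noteq> 0} \<union> {d. homogeneous_part y d \<noteq> 0}"
  have fin: "finite ?D" using homogeneous_part x y by simp
  have sums: "(\<Sum>d\<in>?D. homogeneous_part x d) = x" "(\<Sum>d\<in>?D. homogeneous_part y d) = y"
  proof -
    have "(\<Sum>d\<in>?D. homogeneous_part x d) = (\<Sum>d | homogeneous_part x d \<noteq> 0. homogeneous_part x d)"
      "(\<Sum>d\<in>?D. homogeneous_part y d) = (\<Sum>d | homogeneous_part y d \<noteq> 0. homogeneous_part y d)"
      by (rule sum.mono_neutral_right[OF fin]; simp)+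
    then show "(\<Sum>d\<in>?D. homogeneous_part x d) = x" "(\<Sum>d\<in>?D. homogeneous_part y d) = y"
      using homogeneous_part(3)[OF x] homogeneous_part(3)[OF y] by simp_all
  qed
  have eq: "homogeneous_part (x + scale c y) = (\<lambda>d. homogeneous_part x d + scale c (homogeneous_part y d))"
  proof (rule homogeneous_part_eqI[OF _ fin])
    show "x + scale c y \<in> V"
      using x y subspace_carrier by (simp add: subspace_add subspace_scale)
    show "homogeneous_part x d + scale c (homogeneous_part y d) \<in> G d" for d
      using homogeneous_part x y subspace_component by (simp add: subspace_add subspace_scale)
    show "(\<Sum>d\<in>?D. homogeneous_part x d + scale c (homogeneous_part y d)) = x + scale c y"
      by (simp only: sum.distrib sums scale_sum_right[symmetric])
  qed auto
  have "weight q (x + scale c y) = (\<Sum>d\<in>?D. scale (q powi d) (homogeneous_part x d + scale c (homogeneous_part y d)))"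
    using weight_eq_sum[OF fin, of "x + scale c y" q] unfolding eq by auto
  moreover have "weight q x = (\<Sum>d\<in>?D. scale (q powi d) (homogeneous_part x d))"
    "weight q y = (\<Sum>d\<in>?D. scale (q powi d) (homogeneous_part y d))"
    by (rule weight_eq_sum[OF fin]; simp)+
  ultimately show ?thesis
    by (simp add: scale_right_distrib sum.distrib scale_sum_right mult.commute)
qed

lemma weight_closed: "v \<in> V \<Longrightarrow> weight q v \<in> V"
  unfolding weight_def using homogeneous_part(2) component_subset subspace_carrier
  by (intro subspace_sum subspace_scale) blast+

lemma weight_homogeneous:
  assumes "v \<in> G d"
  shows "weight q v = scale (q powi d) v"
proof -
  have "homogeneous_part v = (\<lambda>e. if e = d then v else 0)"
    using assms component_subset subspace_component
    by (intro homogeneous_part_eqI[of _ "{d}"]) (auto simp: subspace_0)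
  then show ?thesis by (subst weight_eq_sum[of "{d}"]) auto
qed

lemma homogeneous_subset: "homogeneous G vs ds \<Longrightarrow> set vs \<subseteq> V"
  unfolding homogeneous_def using component_subset
  by (fastforce simp: list_all2_conv_all_nth in_set_conv_nth)

lemma multilinear_on_weight_prefix:
  assumes f: "multilinear_on scale V scale' n f" and W: "vector_space scale'"
  shows "multilinear_on scale V scale' n (\<lambda>vs. f (map (weight q) (take a vs) @ drop a vs))"
proof (rule multilinear_onI[OF W subspace_carrier])
  fix vs l x y c
  assume v: "length vs = n" "set vs \<subseteq> V" "l < n" "x \<in> V" "y \<in> V"
  let ?w = "\<lambda>vs. map (weight q) (take a vs) @ drop a vs"
  have upd: "?w (vs[l := z]) = (?w vs)[l := if l < a then weight q z else z]" for z
    using v take_update_swap[of a vs l z]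
    by (cases "l < a") (simp_all add: drop_update_swap list_update_append map_update)
  have "set (?w vs) \<subseteq> V"
    using v(2) weight_closed set_take_subset[of a vs] set_drop_subset[of a vs] by auto
  then show "f (?w (vs[l := x + scale c y])) = f (?w (vs[l := x])) + scale' c (f (?w (vs[l := y])))"
    unfolding upd using multilinear_on_lincomb[OF f subspace_carrier, of "?w vs" l] v
    by (auto simp: weight_lincomb weight_closed)
qed

text \<open>
  For \<open>q = - 1\<close> the scalar is the Koszul sign of the letters \<open>p\<close>, here in a form that is
  multilinear in all letters.
\<close>

lemma multilinear_on_weight_prefix_homogeneous:
  assumes f: "multilinear_on scale V scale' n f" and W: "vector_space scale'" and q: "q \<noteq> 0"
    and p: "homogeneous G p ds" and r: "set r \<subseteq> V" and n: "length p + length r = n"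
  shows "f (map (weight q) p @ r) = scale' (q powi sum_list ds) (f (p @ r))"
proof -
  interpret W: vector_space scale' by (rule W)
  have "f (s @ map (weight q) p @ r) = scale' (q powi sum_list ds) (f (s @ p @ r))"
    if "set s \<subseteq> V" "length s + length p + length r = n" for s
    using p[unfolded homogeneous_def] that
  proof (induction arbitrary: s rule: list_all2_induct)
    case Nil
    then show ?case by simp
  next
    case (Cons v p d ds)
    have vV: "v \<in> V" using Cons.hyps component_subset by auto
    have "set p \<subseteq> V" using homogeneous_subset[of p ds] Cons.hyps by (simp add: homogeneous_def)
    then have wV: "set (map (weight q) p) \<subseteq> V" using weight_closed by auto
    have "f (s @ map (weight q) (v # p) @ r) = f (s @ [scale (q powi d) v] @ (map (weight q) p @ r))"
      using Cons.hyps by (simp add: weight_homogeneous)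
    also have "\<dots> = scale' (q powi d) (f (s @ [v] @ (map (weight q) p @ r)))"
      using multilinear_on_lincomb_sum[OF f subspace_carrier W, of s "map (weight q) p @ r" "{()}" "\<lambda>_. v" "\<lambda>_. q powi d"]
        Cons.prems r wV vV by simp
    also have "f (s @ [v] @ (map (weight q) p @ r)) = scale' (q powi sum_list ds) (f ((s @ [v]) @ p @ r))"
      using Cons.IH[of "s @ [v]"] Cons.prems vV by simp
    finally show ?case using q by (simp add: power_int_add)
  qed
  from this[of "[]"] n show ?thesis by simp
qed

lemma span_components: "span (\<Union>d. G d) = V"
proof
  show "span (\<Union>d. G d) \<subseteq> V"
    using component_subset subspace_carrier by (intro span_minimal) auto
  show "V \<subseteq> span (\<Union>d. G d)"
  proof
    fix v assume v: "v \<in> V"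
    have "(\<Sum>d | homogeneous_part v d \<noteq> 0. homogeneous_part v d) \<in> span (\<Union>d. G d)"
      using homogeneous_part(2)[OF v] by (intro span_sum span_base) auto
    then show "v \<in> span (\<Union>d. G d)" using homogeneous_part(3)[OF v] by simp
  qed
qed

lemma tensor_component_subset: "tensor_component scale V G d \<subseteq> tensor_algebra scale V"
  unfolding tensor_component_def tensor_algebra_eq_span
  by (rule tensor.span_mono) (use homogeneous_subset in blast)

lemma tensor_algebra_subset_span_components:
  "tensor_algebra scale V \<subseteq> tensor.span (\<Union>d. tensor_component scale V G d)"
  unfolding tensor_algebra_eq_span
proof (rule tensor.span_minimal[OF _ tensor.subspace_span], safe)
  fix vs assume vs: "vs \<noteq> []" "set vs \<subseteq> V"
  show "pure_tensor scale V vs \<in> tensor.span (\<Union>d. tensor_component scale V G d)"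
  proof (rule multilinear_on_span[where V = V and scale' = tensor_scale and n = "length vs"
        and Ss = "replicate (length vs) (\<Union>d. G d)"])
    show "multilinear_on scale V tensor_scale (length vs) (pure_tensor scale V)"
      using vs by (intro pure_tensor_multilinear) (simp add: Suc_leI)
    show "list_all2 (\<lambda>x S. x \<in> span S) vs (replicate (length vs) (\<Union>d. G d))"
      using vs by (auto simp: list_all2_conv_all_nth span_components)
  next
    fix us assume us: "list_all2 (\<in>) us (replicate (length vs) (\<Union>d. G d))"
    then have "\<forall>i<length us. \<exists>d. us ! i \<in> G d" by (auto simp: list_all2_conv_all_nth)
    then obtain d where d: "\<And>i. i < length us \<Longrightarrow> us ! i \<in> G (d i)" by metis
    have hom: "homogeneous G us (map d [0..<length us])"
      using d by (auto simp: homogeneous_def list_all2_conv_all_nth)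
    moreover have "us \<noteq> []" using vs us by auto
    ultimately have "pure_tensor scale V us \<in> tensor_component scale V G (sum_list (map d [0..<length us]))"
      unfolding tensor_component_def by (intro tensor.span_base) blast
    then show "pure_tensor scale V us \<in> tensor.span (\<Union>d. tensor_component scale V G d)"
      by (intro tensor.span_base) blast
  qed (use component_subset subspace_carrier tensor.vector_space_axioms in auto)
qed

text \<open>
  The operator \<open>weight q\<close> acts on multilinear forms by substitution, hence on tensors by duality, and
  \<open>tensor_component scale V G d\<close> consists of eigenvectors for the eigenvalue \<open>q\<^sup>d\<close>.
\<close>

lemma tensor_component_independent:
  fixes q :: 'k
  assumes q: "inj (\<lambda>d::int. q powi d)" and D: "finite D"
    and c: "\<And>d. d \<in> D \<Longrightarrow> c d \<in> tensor_component scale V G d" and sum: "(\<Sum>d\<in>D. c d) = 0" and d: "d \<in> D"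
  shows "c d = 0"
proof -
  have q0: "q \<noteq> 0"
  proof
    assume "q = 0"
    then have "q powi 1 = q powi 2" by simp
    then show False using injD[OF q, of 1 2] by simp
  qed
  \<comment> \<open>tensors in the algebra vanish on functions that are not multilinear forms, and so must their images\<close>
  define S :: "('v, 'k) tensor \<Rightarrow> ('v, 'k) tensor" where
    "S T = (\<lambda>\<phi>. if multilinear_form scale V \<phi> then T (\<phi> \<circ> map (weight q)) else 0)" for T
  have lin: "Vector_Spaces.linear tensor_scale tensor_scale S"
    using tensor.vector_space_axioms
    by (auto simp: Vector_Spaces.linear_iff S_def tensor_scale_def fun_eq_iff)
  have pure: "S (pure_tensor scale V vs) = tensor_scale (q powi sum_list ds) (pure_tensor scale V vs)"
    if vs: "vs \<noteq> []" "homogeneous G vs ds" for vs ds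
  proof
    fix \<phi>
    have K: "vector_space ((*) :: 'k \<Rightarrow> 'k \<Rightarrow> 'k)" by unfold_locales (auto simp: algebra_simps)
    show "S (pure_tensor scale V vs) \<phi> = tensor_scale (q powi sum_list ds) (pure_tensor scale V vs) \<phi>"
    proof (cases "multilinear_form scale V \<phi>")
      case True
      then have \<phi>: "multilinear_on scale V (*) n \<phi>" if "n \<ge> 1" for n
        using that by (simp add: multilinear_form_def)
      have "multilinear_on scale V (*) n (\<phi> \<circ> map (weight q))" if "n \<ge> 1" for n
        using multilinear_on_weight_prefix[OF \<phi>[OF that] K, of q n]
        unfolding multilinear_on_def by (auto simp: o_def)
      then have "multilinear_form scale V (\<phi> \<circ> map (weight q))"
        by (simp add: multilinear_form_def)
      moreover have "\<phi> (map (weight q) vs @ []) = q powi sum_list ds * \<phi> (vs @ [])"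
        by (rule multilinear_on_weight_prefix_homogeneous[OF \<phi> K q0 vs(2)])
          (use vs in \<open>auto simp: Suc_leI\<close>)
      ultimately show ?thesis using True by (simp add: S_def pure_tensor_def tensor_scale_def)
    qed (simp add: S_def pure_tensor_def tensor_scale_def)
  qed
  have eig: "S x = tensor_scale (q powi e) x" if "x \<in> tensor_component scale V G e" for x e
  proof -
    interpret TT: vector_space_pair "tensor_scale :: 'k \<Rightarrow> ('v, 'k) tensor \<Rightarrow> _" "tensor_scale :: 'k \<Rightarrow> ('v, 'k) tensor \<Rightarrow> _" ..
    have "Vector_Spaces.linear tensor_scale tensor_scale (\<lambda>x :: ('v, 'k) tensor. tensor_scale (q powi e) x)"
      using tensor.vector_space_axioms
      by (auto simp: Vector_Spaces.linear_iff tensor_scale_def fun_eq_iff algebra_simps)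
    from TT.linear_eq_on[OF lin this that[unfolded tensor_component_def]] show ?thesis
      using pure by blast
  qed
  show ?thesis
    by (rule tensor.eigenvectors_sum_eq_0[OF lin D _ _ sum d, of "\<lambda>d. q powi d"])
      (use eig c q in \<open>auto simp: inj_on_def inj_def\<close>)
qed

lemma graded_vector_space_tensor_algebra:
  fixes q :: 'k
  assumes q: "inj (\<lambda>d::int. q powi d)"
  shows "graded_vector_space tensor_scale (tensor_algebra scale V) (tensor_component scale V G)"
proof
  show "tensor.subspace (tensor_algebra scale V)"
    unfolding tensor_algebra_def by (rule tensor.subspace_span)
  show C: "tensor.subspace (tensor_component scale V G d)" for d
    unfolding tensor_component_def by (rule tensor.subspace_span)
  show "tensor_component scale V G d \<subseteq> tensor_algebra scale V" for d
    by (rule tensor_component_subset)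
  fix x assume "x \<in> tensor_algebra scale V"
  then have "x \<in> tensor.span (\<Union>d. tensor_component scale V G d)"
    using tensor_algebra_subset_span_components by blast
  from tensor.finite_sum_if_in_span_UN[of "tensor_component scale V G", OF C this]
  obtain c D where cD: "finite D" "\<And>d. c d \<in> tensor_component scale V G d"
    "\<And>d. d \<notin> D \<Longrightarrow> c d = 0" "(\<Sum>d\<in>D. c d) = x"
    by metis
  show "\<exists>!c. finite {d. c d \<noteq> 0} \<and> (\<forall>d. c d \<in> tensor_component scale V G d) \<and> (\<Sum>d | c d \<noteq> 0. c d) = x"
  proof (rule ex1I[of _ c])
    have sub: "{d. c d \<noteq> 0} \<subseteq> D" using cD by auto
    have "(\<Sum>d | c d \<noteq> 0. c d) = (\<Sum>d\<in>D. c d)"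
      using cD by (intro sum.mono_neutral_left) auto
    then show "finite {d. c d \<noteq> 0} \<and> (\<forall>d. c d \<in> tensor_component scale V G d) \<and> (\<Sum>d | c d \<noteq> 0. c d) = x"
      using cD sub finite_subset by blast
  next
    fix c' assume c': "finite {d. c' d \<noteq> 0} \<and> (\<forall>d. c' d \<in> tensor_component scale V G d) \<and> (\<Sum>d | c' d \<noteq> 0. c' d) = x"
    let ?E = "D \<union> {d. c' d \<noteq> 0}"
    have E: "finite ?E" using cD c' by simp
    have "(\<Sum>d\<in>?E. c d) = (\<Sum>d\<in>D. c d)"
      using cD E by (intro sum.mono_neutral_right) auto
    moreover have "(\<Sum>d\<in>?E. c' d) = (\<Sum>d | c' d \<noteq> 0. c' d)"
      using E by (intro sum.mono_neutral_right) auto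
    ultimately have z: "(\<Sum>d\<in>?E. c' d - c d) = 0"
      using c' cD by (simp add: sum_subtractf)
    have "c' d - c d = 0" if "d \<in> ?E" for d
      by (rule tensor_component_independent[OF q E _ z that])
        (use c' cD C tensor.subspace_diff in blast)
    moreover have "c' d = c d" if "d \<notin> ?E" for d using that cD by auto
    ultimately show "c' = c" by (metis eq_iff_diff_eq_0 ext)
  qed
qed

end

section \<open>Extension of blockwise multilinear maps to tensors\<close>

definition words :: "'v set \<Rightarrow> 'v list set" where
  "words V = {u. u \<noteq> [] \<and> set u \<subseteq> V}"

lemma words_update: "u \<in> words V \<Longrightarrow> x \<in> V \<Longrightarrow> u[i := x] \<in> words V"
  using set_update_subset_insert[of u i x] by (auto simp: words_def)

text \<open>
  Evaluates the function \<open>f\<close> of several words on the tensor product of the functionals \<open>Ts\<close>: the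
  functional in front is applied to \<open>f\<close> as a function of the first word, after the other ones have been
  applied to the remaining words.
\<close>

primrec extend :: "('v list list \<Rightarrow> 'k) \<Rightarrow> ('v, 'k) tensor list \<Rightarrow> 'k" where
  "extend f [] = f []"
| "extend f (T # Ts) = T (\<lambda>u. extend (\<lambda>us. f (u # us)) Ts)"

text \<open>
  Multilinear in the letters of every word.  The lengths of the words are arbitrary, as a multilinear
  form comprises an \<open>n\<close>-linear form for every \<open>n\<close>.
\<close>

definition blockwise_multilinear ::
  "('k::field \<Rightarrow> 'v::ab_group_add \<Rightarrow> 'v) \<Rightarrow> 'v set \<Rightarrow> nat \<Rightarrow> ('v list list \<Rightarrow> 'k) \<Rightarrow> bool" where
  "blockwise_multilinear scale V k f \<longleftrightarrow>
     (\<forall>pre post. length pre + 1 + length post = k \<and> set pre \<subseteq> words V \<and> set post \<subseteq> words V \<longrightarrow>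
        multilinear_form scale V (\<lambda>u. f (pre @ [u] @ post)))"

lemma blockwise_multilinear_Cons:
  assumes "blockwise_multilinear scale V (Suc k) f" "u \<in> words V"
  shows "blockwise_multilinear scale V k (\<lambda>us. f (u # us))"
  unfolding blockwise_multilinear_def
proof (intro allI impI, elim conjE)
  fix pre post
  assume "length pre + 1 + length post = k" "set pre \<subseteq> words V" "set post \<subseteq> words V"
  then have "length (u # pre) + 1 + length post = Suc k \<and> set (u # pre) \<subseteq> words V \<and> set post \<subseteq> words V"
    using assms(2) by auto
  then have "multilinear_form scale V (\<lambda>v. f ((u # pre) @ [v] @ post))"
    using assms(1) unfolding blockwise_multilinear_def by blast
  then show "multilinear_form scale V (\<lambda>v. f (u # pre @ [v] @ post))" by simp
qed

lemma vector_space_field: "vector_space ((*) :: 'k::field \<Rightarrow> 'k \<Rightarrow> 'k)"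
  by unfold_locales (auto simp: algebra_simps)

lemma pure_tensor_in_tensor_algebra: "u \<in> words V \<Longrightarrow> pure_tensor scale V u \<in> tensor_algebra scale V"
  unfolding tensor_algebra_eq_span words_def by (intro tensor.span_base) auto

lemma subspace_tensor_algebra: "tensor.subspace (tensor_algebra scale V)"
  unfolding tensor_algebra_def by (rule tensor.subspace_span)

context vector_space
begin

lemma multilinear_formI:
  assumes V: "subspace V"
    and "\<And>vs i x y c. vs \<in> words V \<Longrightarrow> i < length vs \<Longrightarrow> x \<in> V \<Longrightarrow> y \<in> V \<Longrightarrow>
      \<phi> (vs[i := x + scale c y]) = \<phi> (vs[i := x]) + c * \<phi> (vs[i := y])"
  shows "multilinear_form scale V \<phi>"
  unfolding multilinear_form_def
proof (intro allI impI)
  fix n :: nat assume "n \<ge> 1"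
  then show "multilinear_on scale V (*) n \<phi>"
    by (intro multilinear_onI[OF vector_space_field V] assms(2)) (auto simp: words_def)
qed

lemma multilinear_form_lincomb:
  assumes "multilinear_form scale V \<phi>" "subspace V"
    and "vs \<in> words V" "i < length vs" "x \<in> V" "y \<in> V"
  shows "\<phi> (vs[i := x + scale c y]) = \<phi> (vs[i := x]) + c * \<phi> (vs[i := y])"
  by (rule multilinear_on_lincomb[where scale' = "(*)" and V = V and n = "length vs"])
    (use assms in \<open>auto simp: multilinear_form_def words_def Suc_le_eq\<close>)

text \<open>
  Tensors are additive on multilinear forms only, and see only the values on nonempty words over
  \<open>V\<close>.  This form of linearity includes the invariance under changing \<open>\<chi>\<close> elsewhere.
\<close>

lemma tensor_apply_lincomb:
  assumes T: "T \<in> tensor_algebra scale V" and V: "subspace V"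
    and \<phi>: "multilinear_form scale V \<phi>" and \<psi>: "multilinear_form scale V \<psi>"
    and \<chi>: "\<And>u. u \<in> words V \<Longrightarrow> \<chi> u = \<phi> u + c * \<psi> u"
  shows "T \<chi> = T \<phi> + c * T \<psi>"
proof -
  have form: "multilinear_form scale V \<chi>"
  proof (rule multilinear_formI[OF V])
    fix vs i x y a assume a: "vs \<in> words V" "i < length vs" "x \<in> V" "y \<in> V"
    have "x + scale a y \<in> V" using a V by (simp add: subspace_add subspace_scale)
    then show "\<chi> (vs[i := x + scale a y]) = \<chi> (vs[i := x]) + a * \<chi> (vs[i := y])"
      using a multilinear_form_lincomb[OF \<phi> V a] multilinear_form_lincomb[OF \<psi> V a]
      by (simp add: \<chi> words_update algebra_simps)
  qed
  show ?thesis
    using T[unfolded tensor_algebra_eq_span]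
  proof (induction rule: tensor.span_induct_alt)
    case base
    show ?case by simp
  next
    case (step a x y)
    then have "x \<chi> = x \<phi> + c * x \<psi>"
      using form \<phi> \<psi> \<chi> by (auto simp: pure_tensor_def words_def)
    then show ?case using step by (simp add: tensor_scale_def algebra_simps)
  qed
qed

text \<open>
  The inductive step shared by the next two results: the argument given to the front tensor is a
  multilinear form as soon as the extension to the remaining tensors is linear in the function that is
  extended.
\<close>

lemma multilinear_form_extend_if_lincomb:
  assumes V: "subspace V" and F: "blockwise_multilinear scale V (Suc k) F"
    and lin: "\<And>f g h c. blockwise_multilinear scale V k f \<Longrightarrow> blockwise_multilinear scale V k g \<Longrightarrow>
      (\<And>us. length us = k \<Longrightarrow> set us \<subseteq> words V \<Longrightarrow> h us = f us + c * g us) \<Longrightarrow>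
      extend h Ts = extend f Ts + c * extend g Ts"
  shows "multilinear_form scale V (\<lambda>u. extend (\<lambda>us. F (u # us)) Ts)"
proof (rule multilinear_formI[OF V])
  fix vs i x y c assume a: "vs \<in> words V" "i < length vs" "x \<in> V" "y \<in> V"
  show "extend (\<lambda>us. F (vs[i := x + scale c y] # us)) Ts =
      extend (\<lambda>us. F (vs[i := x] # us)) Ts + c * extend (\<lambda>us. F (vs[i := y] # us)) Ts"
  proof (rule lin)
    fix us assume us: "length us = k" "set us \<subseteq> words V"
    then have "length [] + 1 + length us = Suc k \<and> set [] \<subseteq> words V \<and> set us \<subseteq> words V" by simp
    then have "multilinear_form scale V (\<lambda>u. F ([] @ [u] @ us))"
      using F unfolding blockwise_multilinear_def by blast
    from multilinear_form_lincomb[OF this V a]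
    show "F (vs[i := x + scale c y] # us) = F (vs[i := x] # us) + c * F (vs[i := y] # us)" by simp
  qed (use a words_update in \<open>auto intro!: blockwise_multilinear_Cons[OF F]\<close>)
qed

lemma extend_lincomb:
  assumes V: "subspace V"
    and "blockwise_multilinear scale V k f" "blockwise_multilinear scale V k g"
    and "\<And>us. length us = k \<Longrightarrow> set us \<subseteq> words V \<Longrightarrow> h us = f us + c * g us"
    and "length Ts = k" "set Ts \<subseteq> tensor_algebra scale V"
  shows "extend h Ts = extend f Ts + c * extend g Ts"
  using assms(2-)
proof (induction Ts arbitrary: k f g h c)
  case Nil
  then show ?case by simp
next
  case (Cons T Ts)
  then obtain l where k: "k = Suc l" "length Ts = l" by auto
  note IH = Cons.IH[OF _ _ _ k(2)]
  have Ts: "set Ts \<subseteq> tensor_algebra scale V" using Cons.prems by simp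
  have form: "multilinear_form scale V (\<lambda>u. extend (\<lambda>us. F (u # us)) Ts)"
    if "blockwise_multilinear scale V k F" for F
    by (rule multilinear_form_extend_if_lincomb[OF V that[unfolded k] IH[OF _ _ _ Ts]])
  have "T (\<lambda>u. extend (\<lambda>us. h (u # us)) Ts) =
      T (\<lambda>u. extend (\<lambda>us. f (u # us)) Ts) + c * T (\<lambda>u. extend (\<lambda>us. g (u # us)) Ts)"
  proof (rule tensor_apply_lincomb[OF _ V form form])
    fix u assume u: "u \<in> words V"
    show "extend (\<lambda>us. h (u # us)) Ts =
        extend (\<lambda>us. f (u # us)) Ts + c * extend (\<lambda>us. g (u # us)) Ts"
      by (rule IH[OF _ _ _ Ts])
        (use Cons.prems u k blockwise_multilinear_Cons in auto)
  qed (use Cons.prems in auto)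
  then show ?case by simp
qed

lemma multilinear_form_extend:
  assumes "subspace V" "blockwise_multilinear scale V (Suc (length Ts)) f"
    and "set Ts \<subseteq> tensor_algebra scale V"
  shows "multilinear_form scale V (\<lambda>u. extend (\<lambda>us. f (u # us)) Ts)"
  by (rule multilinear_form_extend_if_lincomb[OF assms(1,2)])
    (rule extend_lincomb[OF assms(1) _ _ _ refl assms(3)])

lemma extend_pure_tensor:
  assumes V: "subspace V" and "blockwise_multilinear scale V (length uss) f" "set uss \<subseteq> words V"
  shows "extend f (map (pure_tensor scale V) uss) = f uss"
  using assms(2-)
proof (induction uss arbitrary: f)
  case Nil
  then show ?case by simp
next
  case (Cons u uss)
  let ?Ts = "map (pure_tensor scale V) uss"
  have "multilinear_form scale V (\<lambda>v. extend (\<lambda>us. f (v # us)) ?Ts)"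
    by (rule multilinear_form_extend[OF V])
      (use Cons.prems in \<open>auto intro: pure_tensor_in_tensor_algebra\<close>)
  then have "extend f (map (pure_tensor scale V) (u # uss)) = extend (\<lambda>us. f (u # us)) ?Ts"
    by (simp add: pure_tensor_def[of _ _ u])
  also have "\<dots> = f (u # uss)"
    by (rule Cons.IH) (use Cons.prems blockwise_multilinear_Cons in auto)
  finally show ?case .
qed

lemma multilinear_on_extend:
  assumes V: "subspace V" and f: "blockwise_multilinear scale V k f"
  shows "multilinear_on tensor_scale (tensor_algebra scale V) (*) k (extend f)"
proof (rule tensor.multilinear_onI[OF vector_space_field subspace_tensor_algebra])
  fix Ts :: "('b, 'a) tensor list" and i X Y c
  assume "length Ts = k" "set Ts \<subseteq> tensor_algebra scale V" "i < k"
    and X: "X \<in> tensor_algebra scale V" and Y: "Y \<in> tensor_algebra scale V"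
  then show "extend f (Ts[i := X + tensor_scale c Y]) = extend f (Ts[i := X]) + c * extend f (Ts[i := Y])"
    using f
  proof (induction Ts arbitrary: k f i)
    case Nil
    then show ?case by simp
  next
    case (Cons T Ts)
    show ?case
    proof (cases i)
      case 0
      then show ?thesis by (simp add: tensor_scale_def)
    next
      case (Suc l)
      have form: "multilinear_form scale V (\<lambda>u. extend (\<lambda>us. f (u # us)) (Ts[l := Z]))"
        if "Z \<in> tensor_algebra scale V" for Z
        by (rule multilinear_form_extend[OF V])
          (use Cons.prems that set_update_subsetI[of Ts] in auto)
      have "T (\<lambda>u. extend (\<lambda>us. f (u # us)) (Ts[l := X + tensor_scale c Y])) =
          T (\<lambda>u. extend (\<lambda>us. f (u # us)) (Ts[l := X])) + c * T (\<lambda>u. extend (\<lambda>us. f (u # us)) (Ts[l := Y]))"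
      proof (rule tensor_apply_lincomb[OF _ V form[OF X] form[OF Y]])
        fix u assume "u \<in> words V"
        then show "extend (\<lambda>us. f (u # us)) (Ts[l := X + tensor_scale c Y]) =
            extend (\<lambda>us. f (u # us)) (Ts[l := X]) + c * extend (\<lambda>us. f (u # us)) (Ts[l := Y])"
          using Cons.prems Suc X Y
          by (intro Cons.IH[of "k - 1"]) (auto intro: blockwise_multilinear_Cons)
      qed (use Cons.prems in auto)
      moreover have "(T # Ts)[Suc l := Z] = T # Ts[l := Z]" for Z by simp
      ultimately show ?thesis unfolding Suc by (simp only: extend.simps)
    qed
  qed
qed

end

section \<open>The operations on words and on tensors\<close>

text \<open>
  For words of lengths \<open>ns\<close>, the pairs of end points of the intervals \<open>{a..<b}\<close> of positions in the
  concatenation that are nonempty, start in the first word and end in the last word.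
\<close>

definition intervals :: "nat list \<Rightarrow> (nat \<times> nat) set" where
  "intervals ns = {(a, b). a < b \<and> b \<le> sum_list ns \<and> a < hd ns \<and> sum_list (butlast ns) < b}"

lemma finite_intervals: "finite (intervals ns)"
  by (rule finite_subset[of _ "{..sum_list ns} \<times> {..sum_list ns}"]) (auto simp: intervals_def)

lemma koszul_append: "koszul (ds @ es) = koszul ds * (koszul es :: 'k::field)"
  by (simp add: koszul_def power_int_add)

lemma multilinear_on_cong:
  assumes "\<And>vs. length vs = n \<Longrightarrow> f vs = g vs"
  shows "multilinear_on scale V scale' n f \<longleftrightarrow> multilinear_on scale V scale' n g"
  unfolding multilinear_on_def using assms by simp

text \<open>
  The degrees of the letters of \<open>op_at a b w\<close> when those of \<open>w\<close> have the degrees \<open>ds\<close>.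
\<close>

definition deg_at :: "nat \<Rightarrow> nat \<Rightarrow> int list \<Rightarrow> int list" where
  "deg_at a b ds = take a ds @ [sum_list (take (b - a) (drop a ds)) + 1] @ drop b ds"

lemma sum_list_deg_at:
  assumes "a \<le> b"
  shows "sum_list (deg_at a b ds) = sum_list ds + 1"
proof -
  have "ds = take a ds @ take (b - a) (drop a ds) @ drop b ds"
    using assms by (metis append_take_drop_id drop_drop le_add_diff_inverse2)
  then have "sum_list ds = sum_list (take a ds) + sum_list (take (b - a) (drop a ds)) + sum_list (drop b ds)"
    by (metis add.assoc sum_list_append)
  then show ?thesis by (simp add: deg_at_def)
qed

context A_infinity
begin

definition op_at :: "nat \<Rightarrow> nat \<Rightarrow> 'v list \<Rightarrow> 'v list" where
  "op_at a b w = take a w @ [m (b - a) (take (b - a) (drop a w))] @ drop b w"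

text \<open>
  The Koszul sign of the first \<open>a\<close> letters is hidden in the operator \<open>weight (- 1)\<close>, so that the
  expression is defined, and multilinear, for letters that are not homogeneous.
\<close>

definition signed_op_at :: "nat \<Rightarrow> nat \<Rightarrow> 'v list \<Rightarrow> ('v, 'k) tensor" where
  "signed_op_at a b w = pure_tensor scale V
     (map (weight (- 1)) (take a w) @ [m (b - a) (take (b - a) (drop a w))] @ drop b w)"

definition word_op :: "'v list list \<Rightarrow> ('v, 'k) tensor" where
  "word_op uss = (\<Sum>(a, b) \<in> intervals (map length uss). signed_op_at a b (concat uss))"

definition tensor_op :: "nat \<Rightarrow> ('v, 'k) tensor list \<Rightarrow> ('v, 'k) tensor" where
  "tensor_op k Ts = (\<lambda>\<phi>. extend (\<lambda>uss. word_op uss \<phi>) Ts)"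

lemma homogeneous_append:
  "homogeneous G vs ds \<Longrightarrow> homogeneous G ws es \<Longrightarrow> homogeneous G (vs @ ws) (ds @ es)"
  unfolding homogeneous_def by (rule list_all2_appendI)

lemma homogeneous_take: "homogeneous G vs ds \<Longrightarrow> homogeneous G (take a vs) (take a ds)"
  unfolding homogeneous_def by (rule list_all2_takeI)

lemma homogeneous_drop: "homogeneous G vs ds \<Longrightarrow> homogeneous G (drop a vs) (drop a ds)"
  unfolding homogeneous_def by (rule list_all2_dropI)

lemma homogeneous_concat:
  "list_all2 (homogeneous G) uss dss \<Longrightarrow> homogeneous G (concat uss) (concat dss)"
  by (induction rule: list_all2_induct) (auto intro: homogeneous_append simp: homogeneous_def list_all2_appendI)

lemma homogeneous_op_at:
  assumes w: "homogeneous G w ds" and ab: "a < b" "b \<le> length w"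
  shows "homogeneous G (op_at a b w) (deg_at a b ds)"
proof -
  have "homogeneous G (take (b - a) (drop a w)) (take (b - a) (drop a ds))"
    using w by (intro homogeneous_take homogeneous_drop)
  then have "m (b - a) (take (b - a) (drop a w)) \<in> G (sum_list (take (b - a) (drop a ds)) + 1)"
    using ab by (intro op_degree) auto
  then have "homogeneous G [m (b - a) (take (b - a) (drop a w))] [sum_list (take (b - a) (drop a ds)) + 1]"
    by (simp add: homogeneous_def)
  then show ?thesis
    unfolding op_at_def deg_at_def using w
    by (intro homogeneous_append homogeneous_take homogeneous_drop)
qed

lemma signed_op_at_homogeneous:
  assumes w: "homogeneous G w ds" and ab: "a < b" "b \<le> length w"
  shows "signed_op_at a b w = tensor_scale (koszul (take a ds)) (pure_tensor scale V (op_at a b w))"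
  unfolding signed_op_at_def op_at_def koszul_def
proof (rule multilinear_on_weight_prefix_homogeneous[where scale' = tensor_scale])
  let ?r = "[m (b - a) (take (b - a) (drop a w))] @ drop b w"
  show "multilinear_on scale V tensor_scale (length (take a w @ ?r)) (pure_tensor scale V)"
    by (rule pure_tensor_multilinear) simp
  show "homogeneous G (take a w) (take a ds)" using w by (rule homogeneous_take)
  have "set (op_at a b w) \<subseteq> V" using homogeneous_op_at[OF assms] by (rule homogeneous_subset)
  then show "set ?r \<subseteq> V" by (simp add: op_at_def)
qed (auto simp: tensor.vector_space_axioms)

lemma multilinear_on_signed_op_at:
  assumes "a < b" "b \<le> n"
  shows "multilinear_on scale V tensor_scale n (signed_op_at a b)"
proof -
  let ?f = "\<lambda>vs. pure_tensor scale V (map (weight (- 1)) (take a vs) @ drop a vs)"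
  have "multilinear_on scale V tensor_scale (a + 1 + (n - b)) ?f"
    by (intro multilinear_on_weight_prefix pure_tensor_multilinear tensor.vector_space_axioms) simp
  then have "multilinear_on scale V tensor_scale (a + (b - a) + (n - b))
      (\<lambda>vs. ?f (take a vs @ [m (b - a) (take (b - a) (drop a vs))] @ drop (a + (b - a)) vs))"
    using assms
    by (intro multilinear_on_insert op_multilinear op_closed subspace_carrier tensor.vector_space_axioms) auto
  then show ?thesis
    using assms by (subst multilinear_on_cong) (auto simp: signed_op_at_def)
qed

lemma blockwise_multilinear_word_op: "blockwise_multilinear scale V k (\<lambda>uss. word_op uss \<phi>)"
  unfolding blockwise_multilinear_def
proof (intro allI impI, elim conjE)
  fix pre post
  assume pp: "set pre \<subseteq> words V" "set post \<subseteq> words V"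
  show "multilinear_form scale V (\<lambda>u. word_op (pre @ [u] @ post) \<phi>)"
  proof (rule multilinear_formI[OF subspace_carrier])
    fix vs i x y c assume a: "vs \<in> words V" "i < length vs" "x \<in> V" "y \<in> V"
    let ?w = "concat (pre @ [vs] @ post)" and ?l = "length (concat pre) + i"
    let ?I = "intervals (map length (pre @ [vs] @ post))"
    have upd: "word_op (pre @ [vs[i := z]] @ post) = (\<Sum>(a, b)\<in>?I. signed_op_at a b (?w[?l := z]))" for z
      using a(2) by (simp add: word_op_def list_update_append)
    have "signed_op_at a b (?w[?l := x + scale c y]) =
        signed_op_at a b (?w[?l := x]) + tensor_scale c (signed_op_at a b (?w[?l := y]))"
      if "(a, b) \<in> ?I" for a b
    proof (rule multilinear_on_lincomb[OF _ subspace_carrier])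
      show "multilinear_on scale V tensor_scale (length ?w) (signed_op_at a b)"
        using that by (intro multilinear_on_signed_op_at) (auto simp: intervals_def length_concat)
    qed (use a pp in \<open>auto simp: words_def\<close>)
    then have "word_op (pre @ [vs[i := x + scale c y]] @ post) =
        word_op (pre @ [vs[i := x]] @ post) + tensor_scale c (word_op (pre @ [vs[i := y]] @ post))"
      unfolding upd tensor.scale_sum_right sum.distrib[symmetric] by (intro sum.cong) auto
    then show "word_op (pre @ [vs[i := x + scale c y]] @ post) \<phi> =
        word_op (pre @ [vs[i := x]] @ post) \<phi> + c * word_op (pre @ [vs[i := y]] @ post) \<phi>"
      by (simp add: tensor_scale_def)
  qed
qed

lemma tensor_op_pure_tensor:
  assumes "set uss \<subseteq> words V"
  shows "tensor_op k (map (pure_tensor scale V) uss) = word_op uss"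
  unfolding tensor_op_def
  by (rule ext) (rule extend_pure_tensor[OF subspace_carrier blockwise_multilinear_word_op assms])

lemma word_op_homogeneous:
  assumes "list_all2 (homogeneous G) uss dss"
  shows "word_op uss = (\<Sum>(a, b) \<in> intervals (map length uss).
    tensor_scale (koszul (take a (concat dss))) (pure_tensor scale V (op_at a b (concat uss))))"
  unfolding word_op_def
  by (rule sum.cong[OF refl])
    (auto simp: intervals_def length_concat intro!: signed_op_at_homogeneous homogeneous_concat assms)

lemma multilinear_on_tensor_op:
  "multilinear_on tensor_scale (tensor_algebra scale V) tensor_scale k (tensor_op k)"
  using multilinear_on_extend[OF subspace_carrier blockwise_multilinear_word_op]
  unfolding multilinear_on_def tensor_op_def tensor_scale_def plus_fun_def by blast

lemma tensor_op_closed: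
  assumes "length Ts = k" "set Ts \<subseteq> tensor_algebra scale V"
  shows "tensor_op k Ts \<in> tensor_algebra scale V"
proof (rule tensor.multilinear_on_span[OF multilinear_on_tensor_op subspace_tensor_algebra
      tensor.vector_space_axioms subspace_tensor_algebra, where Ss = "replicate k (pure_tensor scale V ` words V)"])
  have "pure_tensor scale V ` words V = {pure_tensor scale V vs | vs. vs \<noteq> [] \<and> set vs \<subseteq> V}"
    by (auto simp: words_def)
  then show "list_all2 (\<lambda>x S. x \<in> tensor.span S) Ts (replicate k (pure_tensor scale V ` words V))"
    using assms by (auto simp: list_all2_conv_all_nth tensor_algebra_eq_span)
next
  fix us assume us: "list_all2 (\<in>) us (replicate k (pure_tensor scale V ` words V))"
  then have "us \<in> lists (pure_tensor scale V ` words V)"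
    by (auto simp: list_all2_conv_all_nth in_set_conv_nth in_lists_conv_set)
  then obtain uss where uss: "us = map (pure_tensor scale V) uss" "set uss \<subseteq> words V"
    unfolding lists_image by (auto simp: lists_eq_set)
  have "signed_op_at a b (concat uss) \<in> tensor_algebra scale V" if ab: "(a, b) \<in> intervals (map length uss)" for a b
  proof -
    let ?w = "concat uss"
    have w: "set ?w \<subseteq> V" using uss(2) by (auto simp: words_def)
    then have sub: "set (take a ?w) \<subseteq> V" "set (take (b - a) (drop a ?w)) \<subseteq> V" "set (drop b ?w) \<subseteq> V"
      by (meson order_trans set_drop_subset set_take_subset)+
    have "m (b - a) (take (b - a) (drop a ?w)) \<in> V"
      using ab sub by (intro op_closed) (auto simp: intervals_def length_concat)
    then show ?thesis
      unfolding signed_op_at_def using sub weight_closed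
      by (intro pure_tensor_in_tensor_algebra) (auto simp: words_def)
  qed
  then have "word_op uss \<in> tensor_algebra scale V"
    unfolding word_op_def by (intro tensor.subspace_sum subspace_tensor_algebra) auto
  then show "tensor_op k us \<in> tensor_algebra scale V"
    unfolding uss(1) tensor_op_pure_tensor[OF uss(2)] .
qed (auto intro: pure_tensor_in_tensor_algebra)

definition pure_homogeneous :: "int \<Rightarrow> ('v, 'k) tensor set" where
  "pure_homogeneous d = {pure_tensor scale V vs | vs ds. vs \<noteq> [] \<and> homogeneous G vs ds \<and> sum_list ds = d}"

lemma pure_homogeneous_list:
  assumes "list_all2 (\<in>) Ts (map pure_homogeneous ds)"
  obtains uss dss where "Ts = map (pure_tensor scale V) uss" "list_all2 (homogeneous G) uss dss"
    "[] \<notin> set uss" "map sum_list dss = ds"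
proof -
  have "list_all2 (\<lambda>T d. T \<in> pure_homogeneous d) Ts ds" using assms by (simp add: list_all2_map2)
  then have "\<exists>uss dss. Ts = map (pure_tensor scale V) uss \<and> list_all2 (homogeneous G) uss dss \<and>
    [] \<notin> set uss \<and> map sum_list dss = ds"
  proof (induction rule: list_all2_induct)
    case Nil
    show ?case by simp
  next
    case (Cons T Ts d ds)
    then obtain u es uss dss where "T = pure_tensor scale V u" "u \<noteq> []" "homogeneous G u es"
      "sum_list es = d" "Ts = map (pure_tensor scale V) uss" "list_all2 (homogeneous G) uss dss"
      "[] \<notin> set uss" "map sum_list dss = ds"
      unfolding pure_homogeneous_def by blast
    then show ?case by (intro exI[of _ "u # uss"] exI[of _ "es # dss"]) auto
  qed
  then show ?thesis using that by blast
qed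

lemma homogeneous_words:
  assumes "list_all2 (homogeneous G) uss dss" "[] \<notin> set uss"
  shows "set uss \<subseteq> words V"
proof
  fix u assume u: "u \<in> set uss"
  then obtain ds where "homogeneous G u ds"
    using assms(1) by (auto simp: list_all2_conv_all_nth in_set_conv_nth)
  then show "u \<in> words V" using u assms(2) homogeneous_subset by (auto simp: words_def)
qed

text \<open>
  The components of the tensor algebra are spanned by pure tensors of homogeneous letters, so a
  multilinear identity or a membership in a subspace need only be checked on these, with the total
  degrees prescribed.
\<close>

lemma tensor_multilinear_on_homogeneous:
  assumes f: "multilinear_on tensor_scale (tensor_algebra scale V) tensor_scale k f"
    and W: "tensor.subspace W" and Ts: "homogeneous (tensor_component scale V G) Ts ds" "length Ts = k"
    and base: "\<And>uss dss. length uss = k \<Longrightarrow> list_all2 (homogeneous G) uss dss \<Longrightarrow> [] \<notin> set uss \<Longrightarrow>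
      map sum_list dss = ds \<Longrightarrow> f (map (pure_tensor scale V) uss) \<in> W"
  shows "f Ts \<in> W"
proof (rule tensor.multilinear_on_span[OF f subspace_tensor_algebra tensor.vector_space_axioms W,
      where Ss = "map pure_homogeneous ds"])
  show len: "length (map pure_homogeneous ds) = k"
    using Ts by (auto simp: homogeneous_def dest: list_all2_lengthD)
  show "list_all2 (\<lambda>x S. x \<in> tensor.span S) Ts (map pure_homogeneous ds)"
    using Ts by (simp add: homogeneous_def tensor_component_def list_all2_map2 pure_homogeneous_def)
  fix S assume "S \<in> set (map pure_homogeneous ds)"
  then show "S \<subseteq> tensor_algebra scale V"
    using homogeneous_subset unfolding pure_homogeneous_def
    by (auto intro!: pure_tensor_in_tensor_algebra simp: words_def; blast)
next
  fix us assume us: "list_all2 (\<in>) us (map pure_homogeneous ds)"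
  then show "f us \<in> W"
  proof (rule pure_homogeneous_list)
    fix uss dss assume u: "us = map (pure_tensor scale V) uss" "list_all2 (homogeneous G) uss dss"
      "[] \<notin> set uss" "map sum_list dss = ds"
    have "length uss = k"
      using list_all2_lengthD[OF u(2)] arg_cong[OF u(4), of length]
        list_all2_lengthD[OF Ts(1)[unfolded homogeneous_def]] Ts(2) by simp
    then show ?thesis unfolding u(1) by (rule base) (rule u)+
  qed
qed

lemma tensor_op_degree:
  assumes "homogeneous (tensor_component scale V G) Ts ds" "length Ts = k"
  shows "tensor_op k Ts \<in> tensor_component scale V G (sum_list ds + 1)"
proof (rule tensor_multilinear_on_homogeneous[OF multilinear_on_tensor_op _ assms])
  show C: "tensor.subspace (tensor_component scale V G (sum_list ds + 1))"
    unfolding tensor_component_def by (rule tensor.subspace_span)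
  fix uss dss
  assume uss: "list_all2 (homogeneous G) uss dss" "[] \<notin> set uss" "map sum_list dss = ds"
  have "sum_list (concat dss) = sum_list ds"
    unfolding uss(3)[symmetric] by (induction dss) auto
  then have "pure_tensor scale V (op_at a b (concat uss)) \<in> tensor_component scale V G (sum_list ds + 1)"
    if "(a, b) \<in> intervals (map length uss)" for a b
    unfolding tensor_component_def
    using homogeneous_op_at[OF homogeneous_concat[OF uss(1)], of a b] that sum_list_deg_at[of a b "concat dss"]
    by (intro tensor.span_base CollectI exI[of _ "op_at a b (concat uss)"] exI[of _ "deg_at a b (concat dss)"])
      (auto simp: intervals_def length_concat op_at_def)
  then show "tensor_op k (map (pure_tensor scale V) uss) \<in> tensor_component scale V G (sum_list ds + 1)"
    unfolding tensor_op_pure_tensor[OF homogeneous_words[OF uss(1,2)]] word_op_homogeneous[OF uss(1)]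
    using C by (intro tensor.subspace_sum) (auto intro: tensor.subspace_scale)
qed

end

section \<open>Cancellation of pairs of intervals\<close>

lemma sum_list_take_drop:
  fixes ns :: "nat list"
  shows "sum_list (take k (drop i ns)) = sum_list (take (i + k) ns) - sum_list (take i ns)"
  by (simp add: take_add)

lemma sum_list_take_mono:
  fixes ns :: "nat list"
  assumes "i \<le> j"
  shows "sum_list (take i ns) \<le> sum_list (take j ns)"
proof -
  have "take j ns = take i ns @ take (j - i) (drop i ns)"
    using assms take_add[of i "j - i" ns] by simp
  then show ?thesis by simp
qed

lemma intervals_segment:
  assumes "i + k \<le> length ns" "k \<ge> 1"
  shows "intervals (take k (drop i ns)) =
    {(a, b). a < b \<and> sum_list (take i ns) + b \<le> sum_list (take (i + k) ns) \<and>
       sum_list (take i ns) + a < sum_list (take (i + 1) ns) \<and>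
       sum_list (take (i + k - 1) ns) < sum_list (take i ns) + b}"
proof -
  let ?B = "\<lambda>l. sum_list (take l ns)"
  have "hd (take k (drop i ns)) = sum_list (take 1 (drop i ns))"
    using assms by (cases "drop i ns") (auto simp: take_Cons')
  then have hd: "hd (take k (drop i ns)) = ?B (i + 1) - ?B i"
    unfolding sum_list_take_drop .
  have "butlast (take k (drop i ns)) = take (k - 1) (drop i ns)"
    using assms by (simp add: butlast_take)
  then have last: "sum_list (butlast (take k (drop i ns))) = ?B (i + k - 1) - ?B i"
    using assms by (simp add: sum_list_take_drop)
  have "?B i \<le> ?B (i + k - 1)" "?B i \<le> ?B (i + k)" "?B i \<le> ?B (i + 1)"
    using assms by (auto intro!: sum_list_take_mono)
  then show ?thesis
    unfolding intervals_def hd last sum_list_take_drop by auto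
qed

text \<open>
  \<open>(a, b)\<close> are the end points of the interval replaced first, in the original word, and \<open>(c, d)\<close>
  those of the second interval, in the word in which the positions \<open>{a..<b}\<close> have shrunk to the single
  position \<open>a\<close>; a position \<open>x > a\<close> of this word stems from position \<open>x + (b - a) - 1\<close>.  The three
  alternatives say that the second interval contains the new letter, lies to its left, or lies to
  its right.  Two positions belong to the same word (\<open>same\<close>) if no word starts after the first and not
  after the second one.
\<close>

definition pair_condition :: "nat list \<Rightarrow> nat \<Rightarrow> nat \<Rightarrow> nat \<Rightarrow> nat \<Rightarrow> bool" where
  "pair_condition ns a b c d \<longleftrightarrow>
     (let first = sum_list (take 1 ns); last = sum_list (take (length ns - 1) ns); N = sum_list ns;
        same = (\<lambda>p q. \<nexists>l. p < sum_list (take l ns) \<and> sum_list (take l ns) \<le> q)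
      in c < d \<and>
       (c \<le> a \<and> a < d \<and> c < first \<and> last < d + (b - a) - 1 \<and> d + (b - a) - 1 \<le> N \<or>
        d \<le> a \<and> c < first \<and> last < b \<and> same (d - 1) a \<or>
        a < c \<and> a < first \<and> same (b - 1) (c + (b - a) - 1) \<and>
          last < d + (b - a) - 1 \<and> d + (b - a) - 1 \<le> N))"

text \<open>
  The comparison of end points in \<open>intervals_merge\<close>.  There \<open>x\<close> and \<open>x1\<close> are the start and the
  end of the word that contains position \<open>a\<close>, \<open>z\<close> and \<open>y\<close> those of the word that contains
  \<open>b - 1\<close>, \<open>f\<close> is the end of the first word and \<open>g\<close> the start of the last word; \<open>i0\<close> and \<open>l0\<close>
  say that the merged word, of length \<open>L\<close>, becomes the first or the last one.
\<close>

lemma merge_arithmetic: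
  fixes x x1 y z f g N a b c d :: nat
  assumes ab: "a < b" "x \<le> a" "a < x1" "z < b" "b \<le> y" "x \<le> y" "y \<le> N" "g \<le> N" "x \<le> g" "z \<le> g" "f \<le> x1"
   and i: "i0 \<Longrightarrow> x = 0 \<and> x1 = f" "\<not> i0 \<Longrightarrow> f \<le> x" and n: "l0 \<Longrightarrow> y = N \<and> z = g" "\<not> l0 \<Longrightarrow> y \<le> g"
   and L: "L = y - x - (b - a) + 1"
  shows "(c < d \<and> d \<le> x + L + (N - y) \<and> c < (if i0 then L else f) \<and>
     (if l0 then x else x + L + (g - y)) < d) \<longleftrightarrow>
    c < d \<and> (c \<le> a \<and> a < d \<and> c < f \<and> g < d + (b - a) - 1 \<and> d + (b - a) - 1 \<le> N \<or>
      d \<le> a \<and> c < f \<and> g < b \<and> x < d \<or>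
      a < c \<and> a < f \<and> c + (b - a) - 1 < y \<and> g < d + (b - a) - 1 \<and> d + (b - a) - 1 \<le> N)"
proof (cases "c < d")
  case True
  obtain e where b: "b = Suc (a + e)" using assms(1) less_imp_Suc_add by blast
  have L': "L + x + e = y" "d + (b - a) - 1 = d + e" "c + (b - a) - 1 = c + e" using b ab L by linarith+
  have first: "c < (if i0 then L else f) \<longleftrightarrow> (if c \<le> a then c < f else a < f \<and> c + e < y)"
  proof (cases i0)
    case True
    then show ?thesis using i(1) ab b L' by (cases "c \<le> a"; simp; arith)
  next
    case False
    then show ?thesis using i(2) ab b L' by (cases "c \<le> a"; simp; arith)
  qed
  have last: "(if l0 then x else x + L + (g - y)) < d \<longleftrightarrow> (if a < d then g < d + e else g < b \<and> x < d)"
  proof (cases l0)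
    case True
    then show ?thesis using n(1) ab b L' by (cases "a < d"; simp; arith)
  next
    case False
    then show ?thesis using n(2) ab b L' by (cases "a < d"; simp; arith)
  qed
  have N: "d \<le> x + L + (N - y) \<longleftrightarrow> (if a < d then d + e \<le> N else True)"
    using ab b L' by (cases "a < d"; simp; arith)
  show ?thesis unfolding first last N L'(2,3)
    using True ab b L' by (cases "c \<le> a"; cases "a < d") auto
qed simp

text \<open>
  The words with numbers \<open>i, \<dots>, i + k - 1\<close> have been merged to one of length \<open>L\<close>.  Which
  intervals are admissible for the outer operation depends on \<open>i\<close> and \<open>k\<close>, but these are determined by
  \<open>a\<close> and \<open>b\<close>, and \<open>pair_condition\<close> does not mention them.
\<close>

lemma intervals_merge:
  assumes ik: "i + k \<le> length ns" "k \<ge> 1" and ab: "a < b"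
    and a: "sum_list (take i ns) \<le> a" "a < sum_list (take (i + 1) ns)"
    and b: "sum_list (take (i + k - 1) ns) < b" "b \<le> sum_list (take (i + k) ns)"
    and L: "L = sum_list (take (i + k) ns) - sum_list (take i ns) - (b - a) + 1"
  shows "(c, d) \<in> intervals (take i ns @ [L] @ drop (i + k) ns) \<longleftrightarrow> pair_condition ns a b c d"
proof -
  let ?B = "\<lambda>l. sum_list (take l ns)"
  let ?n = "length ns" and ?N = "sum_list ns"
  let ?new = "take i ns @ [L] @ drop (i + k) ns"
  note mono = sum_list_take_mono[of _ _ ns]
  have N: "?N = ?B ?n" by simp
  have "?B ?n = ?B (i + k) + sum_list (drop (i + k) ns)"
    by (metis N append_take_drop_id sum_list_append)
  then have sum: "sum_list ?new = ?B i + L + (?N - ?B (i + k))" by simp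
  have hd: "hd ?new = (if i = 0 then L else ?B 1)"
    using ik by (cases ns; cases i) auto
  have last: "sum_list (butlast ?new) =
      (if i + k = ?n then ?B i else ?B i + L + (?B (?n - 1) - ?B (i + k)))"
  proof (cases "i + k = ?n")
    case False
    have "butlast (drop (i + k) ns) = take (?n - 1 - (i + k)) (drop (i + k) ns)"
      by (simp add: butlast_conv_take)
    then have "sum_list (butlast (drop (i + k) ns)) = ?B (?n - 1) - ?B (i + k)"
      using ik False by (simp add: sum_list_take_drop)
    then show ?thesis using False ik by (simp add: butlast_append)
  qed (simp add: butlast_append)
  have same_a: "(\<nexists>l. d - 1 < ?B l \<and> ?B l \<le> a) \<longleftrightarrow> ?B i < d" if "c < d" "d \<le> a"
  proof
    assume "\<nexists>l. d - 1 < ?B l \<and> ?B l \<le> a"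
    then have "\<not> (d - 1 < ?B i \<and> ?B i \<le> a)" by blast
    then show "?B i < d" using a that by linarith
  next
    assume i: "?B i < d"
    show "\<nexists>l. d - 1 < ?B l \<and> ?B l \<le> a"
    proof
      assume "\<exists>l. d - 1 < ?B l \<and> ?B l \<le> a"
      then obtain l where l: "d - 1 < ?B l" "?B l \<le> a" by blast
      show False using mono[of l i] mono[of "i + 1" l] l i a by (cases "l \<le> i") auto
    qed
  qed
  have same_b: "(\<nexists>l. b - 1 < ?B l \<and> ?B l \<le> q) \<longleftrightarrow> q < ?B (i + k)" if "b \<le> q" for q
  proof
    assume "\<nexists>l. b - 1 < ?B l \<and> ?B l \<le> q"
    then have "\<not> (b - 1 < ?B (i + k) \<and> ?B (i + k) \<le> q)" by blast
    then show "q < ?B (i + k)" using b ab by linarith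
  next
    assume q: "q < ?B (i + k)"
    show "\<nexists>l. b - 1 < ?B l \<and> ?B l \<le> q"
    proof
      assume "\<exists>l. b - 1 < ?B l \<and> ?B l \<le> q"
      then obtain l where l: "b - 1 < ?B l" "?B l \<le> q" by blast
      have "\<not> l \<le> i + k - 1" using mono[of l "i + k - 1"] l b by linarith
      moreover have "\<not> i + k \<le> l" using mono[of "i + k" l] l q by linarith
      ultimately show False by linarith
    qed
  qed
  have le: "?B i \<le> ?B (i + k)" "?B (i + k) \<le> ?N" "?B (?n - 1) \<le> ?N" "?B i \<le> ?B (?n - 1)"
    "?B (i + k - 1) \<le> ?B (?n - 1)" "?B 1 \<le> ?B (i + 1)"
    unfolding N using ik by (intro mono; simp)+
  have first: "?B 1 \<le> ?B i" if "i \<noteq> 0" using that by (intro mono) simp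
  have lst: "?B (i + k) \<le> ?B (?n - 1)" if "i + k \<noteq> ?n" using that ik by (intro mono) simp
  have "pair_condition ns a b c d \<longleftrightarrow> c < d \<and>
     (c \<le> a \<and> a < d \<and> c < ?B 1 \<and> ?B (?n - 1) < d + (b - a) - 1 \<and> d + (b - a) - 1 \<le> ?N \<or>
      d \<le> a \<and> c < ?B 1 \<and> ?B (?n - 1) < b \<and> ?B i < d \<or>
      a < c \<and> a < ?B 1 \<and> c + (b - a) - 1 < ?B (i + k) \<and>
        ?B (?n - 1) < d + (b - a) - 1 \<and> d + (b - a) - 1 \<le> ?N)"
  proof -
    have "b \<le> c + (b - a) - 1" if "a < c" using that ab by linarith
    then show ?thesis
      unfolding pair_condition_def Let_def using same_a same_b[of "c + (b - a) - 1"] by blast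
  qed
  also have "\<dots> \<longleftrightarrow> c < d \<and> d \<le> ?B i + L + (?N - ?B (i + k)) \<and> c < (if i = 0 then L else ?B 1) \<and>
      (if i + k = ?n then ?B i else ?B i + L + (?B (?n - 1) - ?B (i + k))) < d"
    by (rule merge_arithmetic[symmetric, OF ab a b le(1,2,3,4,5,6) _ first _ lst L]) auto
  also have "\<dots> \<longleftrightarrow> (c, d) \<in> intervals ?new"
    unfolding intervals_def mem_Collect_eq case_prod_conv sum hd last ..
  finally show ?thesis ..
qed

lemma ex_block:
  fixes ns :: "nat list"
  assumes "p < sum_list ns"
  shows "\<exists>i < length ns. sum_list (take i ns) \<le> p \<and> p < sum_list (take (i + 1) ns)"
proof -
  define l where "l = (LEAST l. p < sum_list (take l ns))"
  have ex: "p < sum_list (take (length ns) ns)" using assms by simp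
  have l: "p < sum_list (take l ns)" "l \<le> length ns"
    unfolding l_def using LeastI[where P = "\<lambda>l. p < sum_list (take l ns)", OF ex]
      Least_le[where P = "\<lambda>l. p < sum_list (take l ns)", OF ex] by simp_all
  then obtain i where i: "l = Suc i" by (cases l) auto
  have "\<not> p < sum_list (take i ns)"
    using not_less_Least[of i "\<lambda>l. p < sum_list (take l ns)"] i unfolding l_def by simp
  then show ?thesis using l i by (intro exI[of _ i]) auto
qed

lemma block_unique:
  fixes ns :: "nat list"
  assumes "sum_list (take i ns) \<le> p" "p < sum_list (take (i + 1) ns)"
    and "sum_list (take j ns) \<le> p" "p < sum_list (take (j + 1) ns)"
  shows "i = j"
proof -
  have "\<not> i + 1 \<le> j" "\<not> j + 1 \<le> i"
    using assms sum_list_take_mono[of "i + 1" j ns] sum_list_take_mono[of "j + 1" i ns] by linarith+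
  then show ?thesis by linarith
qed

text \<open>
  The sum over \<open>(i, k, j)\<close> and the intervals of the words \<open>i, \<dots>, i + k - 1\<close> is a sum over all
  nonempty intervals \<open>{a..<b}\<close> of the whole word.  The pairs of intervals then fall into the three classes of
  \<open>pair_condition\<close>.  Nested pairs are summed over \<open>(a, b)\<close> first; exchanging the roles of the two
  intervals is a bijection between the other two classes.
\<close>

lemma sum_pairs_of_intervals_eq_0:
  fixes H :: "nat \<Rightarrow> nat \<Rightarrow> nat \<Rightarrow> nat \<Rightarrow> 'w::ab_group_add"
  assumes nested: "\<And>c d. c < d \<Longrightarrow> d \<le> sum_list ns \<Longrightarrow>
      (\<Sum>(a, b) \<in> {(a, b). c \<le> a \<and> a < b \<and> b \<le> d}. H a b c (d - (b - a) + 1)) = 0"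
    and disjoint: "\<And>p q r s. p < q \<Longrightarrow> q \<le> r \<Longrightarrow> r < s \<Longrightarrow> s \<le> sum_list ns \<Longrightarrow>
      H r s p q + H p q (r - (q - p) + 1) (s - (q - p) + 1) = 0"
  shows "(\<Sum>(i, k, j) \<in> {(i, k, j). i + k + j = length ns \<and> k \<ge> 1}.
      \<Sum>(a, b) \<in> intervals (take k (drop i ns)).
        \<Sum>(c, d) \<in> intervals (take i ns @ [sum_list (take k (drop i ns)) - (b - a) + 1] @ drop (i + k) ns).
          H (sum_list (take i ns) + a) (sum_list (take i ns) + b) c d) = 0"
proof -
  let ?B = "\<lambda>l. sum_list (take l ns)"
  let ?n = "length ns" and ?N = "sum_list ns"
  let ?I = "{(i, k, j). i + k + j = ?n \<and> k \<ge> 1}"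
  \<comment> \<open>the intervals that start in word \<open>i\<close> and end in word \<open>i + k - 1\<close>\<close>
  define J where "J = (\<lambda>(i, k, j :: nat). {(a, b). a < b \<and> ?B i \<le> a \<and> a < ?B (i + 1) \<and>
    ?B (i + k - 1) < b \<and> b \<le> ?B (i + k)})"
  define P where "P = (\<lambda>(a, b). {(c, d). pair_condition ns a b c d})"
  let ?h = "\<lambda>((a, b), (c, d)). H a b c d"
  note mono = sum_list_take_mono[of _ _ ns]
  have local: "(\<Sum>(a, b) \<in> intervals (take k (drop i ns)).
        \<Sum>(c, d) \<in> intervals (take i ns @ [sum_list (take k (drop i ns)) - (b - a) + 1] @ drop (i + k) ns).
          H (?B i + a) (?B i + b) c d) = (\<Sum>ab \<in> J (i, k, j). \<Sum>cd \<in> P ab. ?h (ab, cd))"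
    if "(i, k, j) \<in> ?I" for i k j
  proof -
    have ik: "i + k \<le> ?n" "k \<ge> 1" using that by auto
    show ?thesis
    proof (rule sum.reindex_bij_witness[where i = "\<lambda>(a, b). (a - ?B i, b - ?B i)" and j = "\<lambda>(a, b). (?B i + a, ?B i + b)"])
      fix ab assume ab: "ab \<in> intervals (take k (drop i ns))"
      obtain a b where [simp]: "ab = (a, b)" by (cases ab)
      have ab': "a < b" "?B i + a < ?B (i + 1)" "?B (i + k - 1) < ?B i + b" "?B i + b \<le> ?B (i + k)"
        using ab intervals_segment[OF ik] by auto
      show "(case ab of (a, b) \<Rightarrow> (?B i + a, ?B i + b)) \<in> J (i, k, j)"
        using ab' by (simp add: J_def)
      show "(case (case ab of (a, b) \<Rightarrow> (?B i + a, ?B i + b)) of (a, b) \<Rightarrow> (a - ?B i, b - ?B i)) = ab" by simp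
      have "intervals (take i ns @ [sum_list (take k (drop i ns)) - (b - a) + 1] @ drop (i + k) ns) = P (?B i + a, ?B i + b)"
        using ab' intervals_merge[OF ik, of "?B i + a" "?B i + b"]
        by (auto simp: P_def sum_list_take_drop)
      then show "(\<Sum>cd \<in> P (case ab of (a, b) \<Rightarrow> (?B i + a, ?B i + b)). ?h (case ab of (a, b) \<Rightarrow> (?B i + a, ?B i + b), cd)) =
        (case ab of (a, b) \<Rightarrow> \<Sum>(c, d) \<in> intervals (take i ns @ [sum_list (take k (drop i ns)) - (b - a) + 1] @ drop (i + k) ns).
          H (?B i + a) (?B i + b) c d)" by simp
    next
      fix ab assume "ab \<in> J (i, k, j)"
      moreover have "?B i \<le> ?B (i + k - 1)" using ik by (intro mono) simp
      ultimately show "(case (case ab of (a, b) \<Rightarrow> (a - ?B i, b - ?B i)) of (a, b) \<Rightarrow> (?B i + a, ?B i + b)) = ab"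
        "(case ab of (a, b) \<Rightarrow> (a - ?B i, b - ?B i)) \<in> intervals (take k (drop i ns))"
        using ik unfolding intervals_segment[OF ik] J_def by auto
    qed
  qed
  let ?U = "{(a, b). a < b \<and> b \<le> ?N}"
  have UJ: "(\<Union>x\<in>?I. J x) = ?U"
  proof (intro equalityI subsetI)
    fix ab assume "ab \<in> (\<Union>x\<in>?I. J x)"
    then obtain i k a b where "ab = (a, b)" "a < b" "b \<le> ?B (i + k)" "i + k \<le> ?n"
      by (auto simp: J_def)
    then show "ab \<in> ?U" using mono[of "i + k" ?n] by auto
  next
    fix ab assume "ab \<in> ?U"
    then obtain a b where ab: "ab = (a, b)" "a < b" "b \<le> ?N" by auto
    obtain i where i: "?B i \<le> a" "a < ?B (i + 1)" using ex_block[of a ns] ab by auto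
    have "b - 1 < ?N" using ab by linarith
    then obtain l where l: "l < ?n" "?B l \<le> b - 1" "b - 1 < ?B (l + 1)" using ex_block by blast
    have il: "i \<le> l" using mono[of "l + 1" i] i l ab by (cases "i \<le> l") auto
    have "(i, l - i + 1, ?n - l - 1) \<in> ?I" using il l(1) by auto
    moreover have "ab \<in> J (i, l - i + 1, ?n - l - 1)"
      using i l(2,3) ab il by (simp add: J_def) linarith
    ultimately show "ab \<in> (\<Union>x\<in>?I. J x)" by blast
  qed
  have disJ: "J x \<inter> J y = {}" if xy: "x \<in> ?I" "y \<in> ?I" "x \<noteq> y" for x y
  proof (rule ccontr)
    assume "J x \<inter> J y \<noteq> {}"
    then obtain a b where ab: "(a, b) \<in> J x" "(a, b) \<in> J y" by auto
    obtain i k j i' k' j' where x: "x = (i, k, j)" and y: "y = (i', k', j')" by (metis prod_cases3)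
    have k: "k \<ge> 1" "k' \<ge> 1" "i + k + j = ?n" "i' + k' + j' = ?n" using xy x y by auto
    have "i = i'" using ab by (intro block_unique[of i ns a i']) (auto simp: J_def x y)
    moreover have "i + k - 1 = i' + k' - 1"
      using ab k by (intro block_unique[of "i + k - 1" ns "b - 1" "i' + k' - 1"]) (auto simp: J_def x y)
    ultimately show False using xy(3) k unfolding x y by auto
  qed
  have finU: "finite ?U" by (rule finite_subset[of _ "{..?N} \<times> {..?N}"]) auto
  have finI: "finite ?I"
    by (rule finite_subset[of _ "{..?n} \<times> {..?n} \<times> {..?n}"]) auto
  have finJ: "finite (J x)" if "x \<in> ?I" for x
    by (rule finite_subset[OF _ finU]) (use that in \<open>simp only: UJ[symmetric] UN_upper\<close>)
  have finP: "finite (P ab)" for ab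
    by (rule finite_subset[of _ "{..?N + fst ab + 1} \<times> {..?N + fst ab + 1}"])
      (auto simp: P_def pair_condition_def Let_def split: prod.splits)
  let ?first = "?B 1" and ?last = "?B (?n - 1)"
  let ?same = "\<lambda>p q. \<nexists>l. p < ?B l \<and> ?B l \<le> q"
  define Q1 where "Q1 = {((a, b), (c, d)). a < b \<and> c \<le> a \<and> a < d \<and> c < ?first \<and>
    ?last < d + (b - a) - 1 \<and> d + (b - a) - 1 \<le> ?N}"
  define Q2 where "Q2 = {((a, b), (c, d)). a < b \<and> b \<le> ?N \<and> c < d \<and> d \<le> a \<and> c < ?first \<and> ?last < b \<and>
    ?same (d - 1) a}"
  define Q3 where "Q3 = {((a, b), (c, d)). a < b \<and> c < d \<and> a < c \<and> a < ?first \<and>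
    ?same (b - 1) (c + (b - a) - 1) \<and> ?last < d + (b - a) - 1 \<and> d + (b - a) - 1 \<le> ?N}"
  have Q: "Sigma ?U P = Q1 \<union> (Q2 \<union> Q3)"
  proof -
    have "((a, b), (c, d)) \<in> Sigma ?U P \<longleftrightarrow> ((a, b), (c, d)) \<in> Q1 \<union> (Q2 \<union> Q3)" for a b c d
    proof -
      have "((a, b), (c, d)) \<in> Sigma ?U P \<longleftrightarrow> a < b \<and> b \<le> ?N \<and> pair_condition ns a b c d"
        by (simp add: P_def)
      moreover have "b \<le> ?N" if "a < b" "a < d" "d + (b - a) - 1 \<le> ?N"
        using that by linarith
      ultimately show ?thesis
        unfolding pair_condition_def Let_def Q1_def Q2_def Q3_def by auto
    qed
    then show ?thesis by (auto simp only: split_paired_all)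
  qed
  have "finite (Sigma ?U P)" using finU finP by (intro finite_SigmaI) auto
  then have fin: "finite Q1" "finite Q2" "finite Q3" unfolding Q by auto
  have Q1: "sum ?h Q1 = 0"
  proof -
    \<comment> \<open>\<open>e\<close> is the right end of the second interval in terms of the original positions\<close>
    let ?C = "{(c, e). c < e \<and> e \<le> ?N \<and> c < ?first \<and> ?last < e}"
    let ?D = "\<lambda>(c, e). {(a, b). c \<le> a \<and> a < b \<and> b \<le> (e :: nat)}"
    let ?g = "\<lambda>((c, e), (a, b)). H a b c (e - (b - a) + 1)"
    have "sum ?h Q1 = sum ?g (Sigma ?C ?D)"
      by (rule sum.reindex_bij_witness[where j = "\<lambda>((a, b), (c, d)). ((c, d + (b - a) - 1), (a, b))"
            and i = "\<lambda>((c, e), (a, b)). ((a, b), (c, e - (b - a) + 1))"])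
        (auto simp: Q1_def)
    also have "\<dots> = (\<Sum>x\<in>?C. \<Sum>y\<in>?D x. ?g (x, y))"
    proof (subst sum.Sigma)
      show "finite ?C" by (rule finite_subset[of _ "{..?N} \<times> {..?N}"]) auto
      show "\<forall>x\<in>?C. finite (?D x)"
      proof
        fix x assume "x \<in> ?C"
        then show "finite (?D x)" by (intro finite_subset[of "?D x" "{..?N} \<times> {..?N}"]) auto
      qed
    qed (simp add: split_def)
    also have "\<dots> = 0"
      using nested by (intro sum.neutral) (auto simp: split_def)
    finally show ?thesis .
  qed
  have "sum ?h Q3 = (\<Sum>((a, b), (c, d))\<in>Q2. H c d (a - (d - c) + 1) (b - (d - c) + 1))"
    by (rule sum.reindex_bij_witness[where i = "\<lambda>((a, b), (c, d)). ((c, d), (a - (d - c) + 1, b - (d - c) + 1))"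
          and j = "\<lambda>((a, b), (c, d)). ((c + (b - a) - 1, d + (b - a) - 1), (a, b))"])
      (auto simp: Q2_def Q3_def)
  then have "sum ?h Q2 + sum ?h Q3 =
      (\<Sum>((a, b), (c, d))\<in>Q2. H a b c d + H c d (a - (d - c) + 1) (b - (d - c) + 1))"
    by (simp add: sum.distrib split_def)
  also have "\<dots> = 0"
    by (rule sum.neutral) (auto simp only: Q2_def mem_Collect_eq case_prod_conv split_paired_all disjoint)
  finally have Q23: "sum ?h Q2 + sum ?h Q3 = 0" .
  have "(\<Sum>(i, k, j) \<in> ?I. \<Sum>(a, b) \<in> intervals (take k (drop i ns)).
        \<Sum>(c, d) \<in> intervals (take i ns @ [sum_list (take k (drop i ns)) - (b - a) + 1] @ drop (i + k) ns).
          H (?B i + a) (?B i + b) c d) = (\<Sum>x\<in>?I. \<Sum>ab \<in> J x. \<Sum>cd \<in> P ab. ?h (ab, cd))"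
    by (rule sum.cong[OF refl]) (use local in \<open>simp only: split_paired_all case_prod_conv\<close>)
  also have "\<dots> = (\<Sum>ab \<in> ?U. \<Sum>cd \<in> P ab. ?h (ab, cd))"
    unfolding UJ[symmetric] using finI finJ disJ by (intro sum.UNION_disjoint[symmetric]) auto
  also have "\<dots> = sum ?h (Sigma ?U P)"
    using finU finP by (subst sum.Sigma) (auto simp: split_def)
  also have "\<dots> = sum ?h Q1 + (sum ?h Q2 + sum ?h Q3)"
    unfolding Q using fin
    by (subst sum.union_disjoint; (subst sum.union_disjoint)?) (auto simp: Q1_def Q2_def Q3_def)
  finally show ?thesis using Q1 Q23 by simp
qed

section \<open>The relations on the tensor algebra\<close>

lemma koszul_square: "koszul ds * koszul ds = (1 :: 'k::field)"
  by (simp add: koszul_def power_int_add[symmetric] flip: mult_2)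

lemma koszul_map_sum_list: "koszul (map sum_list dss) = koszul (concat dss)"
proof -
  have "sum_list (map sum_list dss) = sum_list (concat dss)" by (induction dss) auto
  then show ?thesis by (simp add: koszul_def)
qed

lemma split_at_two:
  assumes "c \<le> d"
  shows "w = take c w @ take (d - c) (drop c w) @ drop d w"
  using assms by (metis append_take_drop_id drop_drop le_add_diff_inverse2)

text \<open>
  On the left, the first factors belong to the operation that is applied first.  If it is the one on the
  left, at \<open>{p..<q}\<close>, it contributes the additional degree 1 to the sign of the other one.
\<close>

lemma koszul_disjoint:
  assumes "p < q" "q \<le> r" "r < s" "s \<le> length ds"
  shows "koszul (take r ds) * koszul (take p (deg_at r s ds)) +
    koszul (take p ds) * koszul (take (r - (q - p) + 1) (deg_at p q ds)) = (0 :: 'k::field)"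
proof -
  have 1: "take p (deg_at r s ds) = take p ds" using assms by (simp add: deg_at_def)
  have r: "r - (q - p) + 1 = p + (1 + (r - q))" using assms by simp
  have 2: "take (r - (q - p) + 1) (deg_at p q ds) =
      take p ds @ [sum_list (take (q - p) (drop p ds)) + 1] @ take (r - q) (drop q ds)"
    unfolding r using assms by (simp add: deg_at_def Suc_diff_le)
  have "take r ds = take p ds @ take (q - p) (drop p ds) @ take (r - q) (drop q ds)"
    using assms split_at_two[of p q "take r ds"] by (simp add: drop_take min_def)
  then have "sum_list (take (r - (q - p) + 1) (deg_at p q ds)) = sum_list (take r ds) + 1"
    unfolding 2 by simp
  then have "koszul (take (r - (q - p) + 1) (deg_at p q ds)) = (- koszul (take r ds) :: 'k)"
    by (simp add: koszul_def power_int_add)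
  then show ?thesis unfolding 1 by simp
qed

context A_infinity
begin

lemma op_at_append:
  "length q = l \<Longrightarrow> op_at (length p) (length p + l) (p @ q @ s) = p @ [m l q] @ s"
  by (simp add: op_at_def)

lemma op_at_middle:
  assumes "a \<le> b" "b \<le> length x"
  shows "op_at (length p + a) (length p + b) (p @ x @ s) = p @ op_at a b x @ s"
  using assms by (simp add: op_at_def)

lemma deg_at_middle:
  assumes "a \<le> b" "b \<le> length x"
  shows "deg_at (length p + a) (length p + b) (p @ x @ s) = p @ deg_at a b x @ s"
  using assms by (simp add: deg_at_def)

lemma op_at_disjoint:
  assumes "p < q" "q \<le> r" "r < s" "s \<le> length w"
  shows "op_at p q (op_at r s w) = op_at (r - (q - p) + 1) (s - (q - p) + 1) (op_at p q w)"
proof -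
  define P Q R S U where "P = take p w" and "Q = take (q - p) (drop p w)" and "R = take (r - q) (drop q w)"
    and "S = take (s - r) (drop r w)" and "U = drop s w"
  have w: "w = P @ Q @ R @ S @ U"
    unfolding P_def Q_def R_def S_def U_def using assms
    by (metis append_take_drop_id drop_drop le_add_diff_inverse2 less_imp_le)
  have len: "length P = p" "length Q = q - p" "length R = r - q" "length S = s - r"
    using assms by (auto simp: P_def Q_def R_def S_def)
  have "op_at r s w = P @ Q @ (R @ [m (s - r) S] @ U)"
    using op_at_append[of S "s - r" "P @ Q @ R" U] len assms w by simp
  then have 1: "op_at p q (op_at r s w) = P @ [m (q - p) Q] @ R @ [m (s - r) S] @ U"
    using op_at_append[of Q "q - p" P "R @ [m (s - r) S] @ U"] len assms by simp
  have "op_at p q w = (P @ [m (q - p) Q] @ R) @ S @ U"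
    using op_at_append[of Q "q - p" P "R @ S @ U"] len assms w by simp
  moreover have "length (P @ [m (q - p) Q] @ R) = r - (q - p) + 1"
    "r - (q - p) + 1 + (s - r) = s - (q - p) + 1" using len assms by auto
  ultimately show ?thesis
    using 1 op_at_append[of S "s - r" "P @ [m (q - p) Q] @ R" U] len by simp
qed

text \<open>
  The summand of the relation in which the interval \<open>{a..<b}\<close> of \<open>w\<close> is replaced first and the
  interval \<open>{c..<d}\<close> of the result second, with the signs of both replacements.
\<close>

definition double_op :: "'v list \<Rightarrow> int list \<Rightarrow> nat \<Rightarrow> nat \<Rightarrow> nat \<Rightarrow> nat \<Rightarrow> ('v, 'k) tensor" where
  "double_op w ds a b c d =
     tensor_scale (koszul (take a ds) * koszul (take c (deg_at a b ds)))
       (pure_tensor scale V (op_at c d (op_at a b w)))"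

lemma double_op_disjoint:
  assumes "p < q" "q \<le> r" "r < s" "s \<le> length w" "length ds = length w"
  shows "double_op w ds r s p q + double_op w ds p q (r - (q - p) + 1) (s - (q - p) + 1) = 0"
  using koszul_disjoint[of p q r s ds, where 'k = 'k] assms
  by (simp only: double_op_def op_at_disjoint tensor.scale_left_distrib[symmetric] tensor.scale_zero_left)

text \<open>
  Both signs contain the letters before \<open>c\<close>, which therefore cancel, and what remains is the
  \<open>A\<^sub>\<infinity>\<close>-relation of \<open>V\<close> for the letters \<open>z\<close> between \<open>c\<close> and \<open>d\<close>, in the context of the
  unchanged letters \<open>P\<close> and \<open>U\<close>.
\<close>

lemma double_op_nested:
  assumes w: "homogeneous G w ds" and cd: "c < d" "d \<le> length w"
  shows "(\<Sum>(a, b) \<in> {(a, b). c \<le> a \<and> a < b \<and> b \<le> d}. double_op w ds a b c (d - (b - a) + 1)) = 0"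
proof -
  define P z U where "P = take c w" and "z = take (d - c) (drop c w)" and "U = drop d w"
  define n dz where "n = d - c" and "dz = take (d - c) (drop c ds)"
  have wP: "w = P @ z @ U"
    unfolding P_def z_def U_def using cd split_at_two[of c d w] by simp
  have len: "length P = c" "length z = n" using cd by (auto simp: P_def z_def n_def)
  have lds: "length ds = length w" using w by (auto simp: homogeneous_def dest: list_all2_lengthD)
  have hz: "homogeneous G z dz"
    unfolding z_def dz_def using w by (intro homogeneous_take homogeneous_drop)
  have V: "set P \<subseteq> V" "set z \<subseteq> V" "set U \<subseteq> V"
    using homogeneous_subset[OF w] unfolding wP by auto
  let ?I = "{(i, k, j). i + k + j = n \<and> k \<ge> 1}"
  let ?y = "\<lambda>(i, k, j). m (i + 1 + j) (take i z @ [m k (take k (drop i z))] @ drop (i + k) z)"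
  let ?c = "\<lambda>(i, k, j). koszul (take i dz)"
  have summand: "double_op w ds a b c (d - (b - a) + 1) =
      tensor_scale (?c (i, k, j)) (pure_tensor scale V (P @ [?y (i, k, j)] @ U))"
    if ab: "a = c + i" "b = c + i + k" "i + k + j = n" for a b i k j
  proof -
    have "op_at a b w = P @ op_at i (i + k) z @ U"
      using op_at_middle[of i "i + k" z P U] ab len wP by (simp add: add.assoc)
    moreover have "op_at i (i + k) z = take i z @ [m k (take k (drop i z))] @ drop (i + k) z"
      by (simp add: op_at_def)
    moreover have "length \<dots> = i + 1 + j" using ab len by simp
    moreover have "d - (b - a) + 1 = length P + (i + 1 + j)" using ab cd len n_def by simp
    ultimately have "op_at c (d - (b - a) + 1) (op_at a b w) = P @ [?y (i, k, j)] @ U"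
      using op_at_append[of "op_at i (i + k) z" "i + 1 + j" P U] len by simp
    moreover have "take c (deg_at a b ds) = take c ds"
      using ab lds cd by (simp add: deg_at_def)
    moreover have "take a ds = take c ds @ take i dz"
      using ab lds cd by (simp add: dz_def take_add n_def min_def)
    ultimately show ?thesis
      using koszul_square[of "take c ds", where 'k = 'k]
      by (simp add: double_op_def koszul_append mult.commute mult.left_commute)
  qed
  have "(\<Sum>(a, b) \<in> {(a, b). c \<le> a \<and> a < b \<and> b \<le> d}. double_op w ds a b c (d - (b - a) + 1)) =
      (\<Sum>x\<in>?I. tensor_scale (?c x) (pure_tensor scale V (P @ [?y x] @ U)))"
    by (rule sum.reindex_bij_witness[where j = "\<lambda>(a, b). (a - c, b - a, d - b)" and i = "\<lambda>(i, k, j). (c + i, c + i + k)"])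
      (use cd in \<open>auto simp: n_def intro!: summand[symmetric, unfolded n_def, simplified]\<close>)
  also have "\<dots> = pure_tensor scale V (P @ [\<Sum>x\<in>?I. scale (?c x) (?y x)] @ U)"
  proof (rule multilinear_on_lincomb_sum[symmetric, where V = V and n = "c + 1 + length U"])
    show "multilinear_on scale V tensor_scale (c + 1 + length U) (pure_tensor scale V)"
      by (rule pure_tensor_multilinear) simp
    show "finite ?I" by (rule finite_subset[of _ "{..n} \<times> {..n} \<times> {..n}"]) auto
    fix x assume "x \<in> ?I"
    then obtain i k j where x: "x = (i, k, j)" "i + k + j = n" "k \<ge> 1" by auto
    have sub: "set (take i z) \<subseteq> V" "set (take k (drop i z)) \<subseteq> V" "set (drop (i + k) z) \<subseteq> V"
      using V(2) by (meson order_trans set_drop_subset set_take_subset)+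
    then have "m k (take k (drop i z)) \<in> V" using x len by (intro op_closed) auto
    then show "?y x \<in> V" using sub x len by (auto intro!: op_closed)
  qed (use V len subspace_carrier tensor.vector_space_axioms in auto)
  also have "(\<Sum>x\<in>?I. scale (?c x) (?y x)) = 0"
    using A_infinity_relation[OF _ len(2) hz] cd by (simp add: n_def split_def)
  also have "pure_tensor scale V (P @ [0] @ U) = 0"
    using multilinear_on_lincomb_sum[of V tensor_scale "length (P @ [0] @ U)" "pure_tensor scale V" P U "{}"]
      pure_tensor_multilinear[of "length (P @ [0] @ U)" scale V] V subspace_carrier tensor.vector_space_axioms
    by simp
  finally show ?thesis .
qed

text \<open>
  One summand of the relation on homogeneous words, rewritten in positions of the concatenated word.
  The sign of the words in front of the inner operation and the sign inside it combine to
  the sign of all letters to the left of the inner interval.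
\<close>

lemma tensor_op_nested_eq:
  assumes uss: "list_all2 (homogeneous G) uss dss" "[] \<notin> set uss"
    and n: "i + k + j = length uss" "k \<ge> 1"
  defines "xs \<equiv> map (pure_tensor scale V) uss" and "ns \<equiv> map length uss"
  shows "tensor_scale (koszul (take i (map sum_list dss)))
      (tensor_op (i + 1 + j) (take i xs @ [tensor_op k (take k (drop i xs))] @ drop (i + k) xs)) =
    (\<Sum>(a, b) \<in> intervals (take k (drop i ns)).
      \<Sum>(c, d) \<in> intervals (take i ns @ [sum_list (take k (drop i ns)) - (b - a) + 1] @ drop (i + k) ns).
        double_op (concat uss) (concat dss) (sum_list (take i ns) + a) (sum_list (take i ns) + b) c d)"
proof -
  define P X Q where "P = take i uss" and "X = take k (drop i uss)" and "Q = drop (i + k) uss"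
  define dP dX dQ where "dP = take i dss" and "dX = take k (drop i dss)" and "dQ = drop (i + k) dss"
  note defs = P_def X_def Q_def dP_def dX_def dQ_def
  have split: "uss = P @ X @ Q" "dss = dP @ dX @ dQ"
    unfolding defs using split_at_two[of i "i + k"] by simp_all
  have hom: "list_all2 (homogeneous G) P dP" "list_all2 (homogeneous G) X dX" "list_all2 (homogeneous G) Q dQ"
    unfolding defs using uss by (auto intro: list_all2_takeI list_all2_dropI)
  have "set uss \<subseteq> words V" using uss by (rule homogeneous_words)
  then have words: "set P \<subseteq> words V" "set X \<subseteq> words V" "set Q \<subseteq> words V" unfolding split by auto
  have xs: "take i xs = map (pure_tensor scale V) P" "take k (drop i xs) = map (pure_tensor scale V) X"
    "drop (i + k) xs = map (pure_tensor scale V) Q"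
    by (simp_all add: xs_def defs take_map drop_map)
  have ns: "take i ns = map length P" "take k (drop i ns) = map length X" "drop (i + k) ns = map length Q"
    by (simp_all add: ns_def defs take_map drop_map)
  have len: "length P = i" "length Q = j" using n by (auto simp: defs)
  have hc: "homogeneous G (concat P) (concat dP)" "homogeneous G (concat X) (concat dX)"
    using hom by (auto intro: homogeneous_concat)
  then have lc: "length (concat dP) = length (concat P)" "length (concat dX) = length (concat X)"
    by (auto simp: homogeneous_def dest: list_all2_lengthD)
  have inner: "tensor_op k (map (pure_tensor scale V) X) = (\<Sum>ab\<in>intervals (map length X).
      tensor_scale (koszul (take (fst ab) (concat dX))) (pure_tensor scale V (op_at (fst ab) (snd ab) (concat X))))"
    unfolding tensor_op_pure_tensor[OF words(2)] word_op_homogeneous[OF hom(2)] by (simp add: split_def)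
  have op_hom: "homogeneous G (op_at a b (concat X)) (deg_at a b (concat dX))"
    if "(a, b) \<in> intervals (map length X)" for a b
    using that by (intro homogeneous_op_at hc) (auto simp: intervals_def length_concat)
  have op_word: "op_at a b (concat X) \<in> words V" if "(a, b) \<in> intervals (map length X)" for a b
    using homogeneous_subset[OF op_hom[OF that]] by (auto simp: words_def op_at_def)
  have outer: "tensor_scale (koszul (map sum_list dP) * koszul (take a (concat dX)))
      (tensor_op (i + 1 + j) (map (pure_tensor scale V) P @ [pure_tensor scale V (op_at a b (concat X))] @
        map (pure_tensor scale V) Q)) =
    (\<Sum>(c, d) \<in> intervals (map length P @ [sum_list (map length X) - (b - a) + 1] @ map length Q).
      double_op (concat uss) (concat dss) (length (concat P) + a) (length (concat P) + b) c d)"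
    if ab: "(a, b) \<in> intervals (map length X)" for a b
  proof -
    let ?N = "P @ [op_at a b (concat X)] @ Q" and ?dN = "dP @ [deg_at a b (concat dX)] @ dQ"
    have b: "a < b" "b \<le> length (concat X)" using ab by (auto simp: intervals_def length_concat)
    have homN: "list_all2 (homogeneous G) ?N ?dN"
      using hom op_hom[OF ab] by (auto intro!: list_all2_appendI)
    have "concat ?N = op_at (length (concat P) + a) (length (concat P) + b) (concat uss)"
      unfolding split using op_at_middle[of a b "concat X" "concat P" "concat Q"] b by simp
    moreover have "concat ?dN = deg_at (length (concat P) + a) (length (concat P) + b) (concat dss)"
      unfolding split using deg_at_middle[of a b "concat dX" "concat dP" "concat dQ"] b lc by simp
    moreover have "length (op_at a b (concat X)) = sum_list (map length X) - (b - a) + 1"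
      using b by (simp add: op_at_def length_concat)
    then have "map length ?N = map length P @ [sum_list (map length X) - (b - a) + 1] @ map length Q"
      by simp
    moreover have "koszul (map sum_list dP) * koszul (take a (concat dX)) =
        (koszul (take (length (concat P) + a) (concat dss)) :: 'k)"
      unfolding split koszul_map_sum_list koszul_append[symmetric] using lc b by simp
    moreover have "tensor_op (i + 1 + j) (map (pure_tensor scale V) ?N) = word_op ?N"
      using words op_word[OF ab] by (intro tensor_op_pure_tensor) auto
    ultimately show ?thesis
      unfolding word_op_homogeneous[OF homN] double_op_def
      by (simp add: tensor.scale_sum_right split_def)
  qed
  have "tensor_op (i + 1 + j) (take i xs @ [tensor_op k (take k (drop i xs))] @ drop (i + k) xs) =
      (\<Sum>ab\<in>intervals (map length X). tensor_scale (koszul (take (fst ab) (concat dX)))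
        (tensor_op (i + 1 + j) (map (pure_tensor scale V) P @
          [pure_tensor scale V (op_at (fst ab) (snd ab) (concat X))] @ map (pure_tensor scale V) Q)))"
    unfolding xs inner
    by (rule tensor.multilinear_on_lincomb_sum[OF multilinear_on_tensor_op subspace_tensor_algebra tensor.vector_space_axioms])
      (use words op_word len finite_intervals in \<open>auto intro: pure_tensor_in_tensor_algebra\<close>)
  then show ?thesis
    unfolding ns using outer
    by (simp add: tensor.scale_sum_right take_map dP_def[symmetric] length_concat split_def)
qed

lemma tensor_op_relation_pure:
  assumes uss: "list_all2 (homogeneous G) uss dss" "[] \<notin> set uss"
  defines "xs \<equiv> map (pure_tensor scale V) uss"
  shows "(\<Sum>(i, k, j) \<in> {(i, k, j). i + k + j = length uss \<and> k \<ge> 1}.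
      tensor_scale (koszul (take i (map sum_list dss)))
        (tensor_op (i + 1 + j) (take i xs @ [tensor_op k (take k (drop i xs))] @ drop (i + k) xs))) = 0"
proof -
  let ?w = "concat uss" and ?ds = "concat dss" and ?ns = "map length uss"
  have w: "homogeneous G ?w ?ds" using uss(1) by (rule homogeneous_concat)
  then have len: "length ?ds = length ?w" by (auto simp: homogeneous_def dest: list_all2_lengthD)
  have N: "sum_list ?ns = length ?w" by (simp add: length_concat)
  have "(\<Sum>(i, k, j) \<in> {(i, k, j). i + k + j = length ?ns \<and> k \<ge> 1}.
      \<Sum>(a, b) \<in> intervals (take k (drop i ?ns)).
        \<Sum>(c, d) \<in> intervals (take i ?ns @ [sum_list (take k (drop i ?ns)) - (b - a) + 1] @ drop (i + k) ?ns).
          double_op ?w ?ds (sum_list (take i ?ns) + a) (sum_list (take i ?ns) + b) c d) = 0"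
  proof (rule sum_pairs_of_intervals_eq_0, goal_cases)
    case (1 c d)
    then show ?case by (intro double_op_nested[OF w]) (simp_all only: N)
  next
    case (2 p q r s)
    then show ?case by (intro double_op_disjoint len) (simp_all only: N)
  qed
  then show ?thesis
    unfolding xs_def using tensor_op_nested_eq[OF uss] by (simp add: split_def)
qed

lemma A_infinity_tensor_op:
  fixes q :: 'k
  assumes q: "inj (\<lambda>d::int. q powi d)"
  shows "A_infinity tensor_scale (tensor_algebra scale V) (tensor_component scale V G) tensor_op"
proof (intro A_infinity.intro A_infinity_axioms.intro graded_vector_space_tensor_algebra[OF q])
  fix n and Ts :: "('v, 'k) tensor list" and ds
  assume n: "n \<ge> 1" and len: "length Ts = n" and Ts: "homogeneous (tensor_component scale V G) Ts ds"
  let ?I = "{(i, k, j). i + k + j = n \<and> k \<ge> 1}"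
  let ?f = "\<lambda>Ts. \<Sum>(i, k, j) \<in> ?I. tensor_scale (koszul (take i ds))
    (tensor_op (i + 1 + j) (take i Ts @ [tensor_op k (take k (drop i Ts))] @ drop (i + k) Ts))"
  have "?f Ts \<in> {0}"
  proof (rule tensor_multilinear_on_homogeneous[OF _ _ Ts len])
    have "multilinear_on tensor_scale (tensor_algebra scale V) tensor_scale n
        (\<lambda>Ts. \<Sum>x \<in> ?I. tensor_scale (koszul (take (fst x) ds)) ((\<lambda>(i, k, j) Ts.
          tensor_op (i + 1 + j) (take i Ts @ [tensor_op k (take k (drop i Ts))] @ drop (i + k) Ts)) x Ts))"
    proof (rule tensor.multilinear_on_sum[OF tensor.vector_space_axioms subspace_tensor_algebra])
      fix x assume "x \<in> ?I"
      then obtain i k j where x: "x = (i, k, j)" "n = i + k + j" by auto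
      show "multilinear_on tensor_scale (tensor_algebra scale V) tensor_scale n ((\<lambda>(i, k, j) Ts.
          tensor_op (i + 1 + j) (take i Ts @ [tensor_op k (take k (drop i Ts))] @ drop (i + k) Ts)) x)"
        unfolding x case_prod_conv
        by (intro tensor.multilinear_on_insert multilinear_on_tensor_op tensor_op_closed
            subspace_tensor_algebra tensor.vector_space_axioms)
    qed
    then show "multilinear_on tensor_scale (tensor_algebra scale V) tensor_scale n ?f"
      by (simp only: split_def)
    show "tensor.subspace {0 :: ('v, 'k) tensor}" by (rule tensor.subspace_single_0)
    fix uss dss
    assume "length uss = n" "list_all2 (homogeneous G) uss dss" "[] \<notin> set uss" "map sum_list dss = ds"
    then show "?f (map (pure_tensor scale V) uss) \<in> {0}"
      using tensor_op_relation_pure[of uss dss] by simp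
  qed
  then show "?f Ts = 0" by simp
qed (use tensor_op_closed multilinear_on_tensor_op tensor_op_degree in auto)

lemma word_op_single:
  assumes "homogeneous G vs ds"
  shows "word_op [vs] = (\<Sum>i = 1..length vs. \<Sum>j = 0..length vs - i.
    tensor_scale (koszul (take j ds))
      (pure_tensor scale V (take j vs @ [m i (take i (drop j vs))] @ drop (j + i) vs)))"
proof -
  have "word_op [vs] = (\<Sum>(a, b) \<in> intervals [length vs].
      tensor_scale (koszul (take a ds)) (pure_tensor scale V (op_at a b vs)))"
    using word_op_homogeneous[of "[vs]" "[ds]"] assms by simp
  also have "\<dots> = (\<Sum>(i, j) \<in> Sigma {1..length vs} (\<lambda>i. {0..length vs - i}). tensor_scale (koszul (take j ds))
      (pure_tensor scale V (take j vs @ [m i (take i (drop j vs))] @ drop (j + i) vs)))"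
    by (rule sum.reindex_bij_witness[where j = "\<lambda>(a, b). (b - a, a)" and i = "\<lambda>(i, j). (j, j + i)"])
      (auto simp: intervals_def op_at_def)
  finally show ?thesis by (simp add: sum.Sigma)
qed

text \<open>
  From two words on, an interval that starts in the first and ends in the last word is given by the
  number \<open>i\<close> of letters kept at the beginning and the number \<open>j\<close> of letters kept at the end, and the
  two numbers are independent.
\<close>

lemma word_op_first_last:
  assumes uss: "list_all2 (homogeneous G) uss dss" "[] \<notin> set uss" "length uss \<ge> 2"
  shows "word_op uss = (\<Sum>i<length (hd uss). \<Sum>j<length (last uss).
    tensor_scale (koszul (take i (hd dss)))
      (pure_tensor scale V (take i (hd uss) @
        [m (length (concat uss) - i - j) (take (length (concat uss) - i - j) (drop i (concat uss)))] @
        drop (length (last uss) - j) (last uss))))"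
proof -
  obtain u vss v where split: "uss = u # vss @ [v]"
    using uss(3) by (metis One_nat_def Suc_1 append_butlast_last_id le_numeral_extra(4) length_Cons list.exhaust list.size(3) not_less_eq_eq zero_le)
  obtain e ess where dss: "dss = e # ess" and e: "homogeneous G u e"
    using uss(1) unfolding split by (auto simp: list_all2_Cons1)
  have le: "length e = length u" using e by (auto simp: homogeneous_def dest: list_all2_lengthD)
  let ?N = "length (concat uss)"
  have N: "?N = length u + length (concat vss) + length v" by (simp add: split)
  have pos: "u \<noteq> []" "v \<noteq> []" using uss(2) by (auto simp: split)
  have "word_op uss = (\<Sum>(a, b) \<in> intervals (map length uss).
      tensor_scale (koszul (take a (concat dss))) (pure_tensor scale V (op_at a b (concat uss))))"
    by (rule word_op_homogeneous[OF uss(1)])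
  also have "\<dots> = (\<Sum>(i, j) \<in> {..<length u} \<times> {..<length v}.
      tensor_scale (koszul (take i e)) (pure_tensor scale V (take i u @
        [m (?N - i - j) (take (?N - i - j) (drop i (concat uss)))] @ drop (length v - j) v)))"
  proof (rule sum.reindex_bij_witness[where j = "\<lambda>(a, b). (a, ?N - b)" and i = "\<lambda>(i, j). (i, ?N - j)"])
    fix ab assume "ab \<in> intervals (map length uss)"
    then obtain a b where ab: "ab = (a, b)" "a < b" "b \<le> ?N" "a < length u" "length u + length (concat vss) < b"
      by (auto simp: intervals_def split length_concat butlast_append)
    then show "(case case ab of (a, b) \<Rightarrow> (a, ?N - b) of (i, j) \<Rightarrow> (i, ?N - j)) = ab"
      "(case ab of (a, b) \<Rightarrow> (a, ?N - b)) \<in> {..<length u} \<times> {..<length v}"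
      using N by auto
    have "?N - a - (?N - b) = b - a" "length v - (?N - b) = b - (length u + length (concat vss))"
      using ab N by linarith+
    then show "(case case ab of (a, b) \<Rightarrow> (a, ?N - b) of (i, j) \<Rightarrow>
        tensor_scale (koszul (take i e)) (pure_tensor scale V (take i u @
          [m (?N - i - j) (take (?N - i - j) (drop i (concat uss)))] @ drop (length v - j) v))) =
      (case ab of (a, b) \<Rightarrow>
        tensor_scale (koszul (take a (concat dss))) (pure_tensor scale V (op_at a b (concat uss))))"
      using ab le by (simp add: op_at_def dss split)
  next
    fix ij assume "ij \<in> {..<length u} \<times> {..<length v}"
    then obtain i j where ij: "ij = (i, j)" "i < length u" "j < length v" by auto
    show "(case case ij of (i, j) \<Rightarrow> (i, ?N - j) of (a, b) \<Rightarrow> (a, ?N - b)) = ij"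
      "(case ij of (i, j) \<Rightarrow> (i, ?N - j)) \<in> intervals (map length uss)"
      using ij N by (auto simp: intervals_def split length_concat butlast_append)
  qed
  moreover have "hd uss = u" "last uss = v" "hd dss = e" by (simp_all add: split dss)
  ultimately show ?thesis by (simp only: sum.cartesian_product)
qed

end

lemma inj_two_powi: "inj (\<lambda>d::int. (2 :: 'k::field_char_0) powi d)"
proof -
  have *: "d \<le> e" if "(2 :: 'k) powi d = 2 powi e" for d e :: int
  proof (rule ccontr)
    assume "\<not> d \<le> e"
    then obtain n where n: "d - e = int n" "n > 0" by (metis diff_gt_0_iff_gt linorder_not_le pos_int_cases)
    have "(2 :: 'k) powi (d - e) = 1" using that by (simp add: power_int_diff)
    then have "(2 :: 'k) ^ n = 1" unfolding n by simp
    then have "of_nat (2 ^ n) = (of_nat 1 :: 'k)" by simp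
    then have "(2 :: nat) ^ n = 1" unfolding of_nat_eq_iff .
    then show False using n by simp
  qed
  show ?thesis by (rule injI) (metis * order_antisym)
qed

theorem theorem6:
  fixes scale :: "'k::field_char_0 \<Rightarrow> 'a::ab_group_add \<Rightarrow> 'a"
    and A :: "'a set" and G :: "int \<Rightarrow> 'a set" and m :: "nat \<Rightarrow> 'a list \<Rightarrow> 'a"
  assumes "A_infinity scale A G m"
  shows "\<exists>t :: nat \<Rightarrow> ('a, 'k) tensor list \<Rightarrow> ('a, 'k) tensor.
    A_infinity tensor_scale (tensor_algebra scale A) (tensor_component scale A G) t \<and>
    (\<forall>vs ds. vs \<noteq> [] \<and> homogeneous G vs ds \<longrightarrow>
      t 1 [pure_tensor scale A vs] =
        (\<Sum>i = 1..length vs. \<Sum>j = 0..length vs - i.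
          tensor_scale (koszul (take j ds))
            (pure_tensor scale A (take j vs @ [m i (take i (drop j vs))] @ drop (j + i) vs)))) \<and>
    (\<forall>vs ds ws es. vs \<noteq> [] \<and> ws \<noteq> [] \<and> homogeneous G vs ds \<and> homogeneous G ws es \<longrightarrow>
      t 2 [pure_tensor scale A vs, pure_tensor scale A ws] =
        (\<Sum>i<length vs. \<Sum>j<length ws.
          tensor_scale (koszul (take i ds))
            (pure_tensor scale A
              (take i vs @
               [m (length vs + length ws - i - j) (drop i vs @ take (length ws - j) ws)] @
               drop (length ws - j) ws)))) \<and>
    (\<forall>k uss dss. k \<ge> 3 \<and> length uss = k \<and> [] \<notin> set uss \<and> list_all2 (homogeneous G) uss dss \<longrightarrow>
      t k (map (pure_tensor scale A) uss) =
        (\<Sum>i<length (hd uss). \<Sum>j<length (last uss).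
          let N = length (concat uss) in
          tensor_scale (koszul (take i (hd dss)))
            (pure_tensor scale A
              (take i (hd uss) @
               [m (N - i - j) (take (N - i - j) (drop i (concat uss)))] @
               drop (length (last uss) - j) (last uss)))))"
proof -
  interpret A_infinity scale A G m by (rule assms)
  let ?t = "pure_tensor scale A"
  have t1: "tensor_op 1 [?t vs] = word_op [vs]" if "vs \<noteq> []" "homogeneous G vs ds" for vs ds
    using tensor_op_pure_tensor[of "[vs]"] that homogeneous_subset by (auto simp: words_def)
  have t: "tensor_op k (map ?t uss) = word_op uss"
    if "[] \<notin> set uss" "list_all2 (homogeneous G) uss dss" for k uss dss
    using homogeneous_words[OF that(2,1)] by (rule tensor_op_pure_tensor)
  have t2: "tensor_op 2 [?t vs, ?t ws] = (\<Sum>i<length vs. \<Sum>j<length ws.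
      tensor_scale (koszul (take i ds)) (?t (take i vs @
        [m (length vs + length ws - i - j) (drop i vs @ take (length ws - j) ws)] @ drop (length ws - j) ws)))"
    if "vs \<noteq> []" "ws \<noteq> []" "homogeneous G vs ds" "homogeneous G ws es" for vs ds ws es
  proof -
    have "tensor_op 2 [?t vs, ?t ws] = word_op [vs, ws]"
      using t[of "[vs, ws]" "[ds, es]" 2] that by simp
    also have "\<dots> = (\<Sum>i<length vs. \<Sum>j<length ws.
      tensor_scale (koszul (take i ds)) (?t (take i vs @
        [m (length vs + length ws - i - j) (drop i vs @ take (length ws - j) ws)] @ drop (length ws - j) ws)))"
      by (subst word_op_first_last[of "[vs, ws]" "[ds, es]"]) (use that in \<open>auto intro!: sum.cong\<close>)
    finally show ?thesis .
  qed
  show ?thesis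
  proof (intro exI[of _ tensor_op] conjI allI impI; (elim conjE)?)
    show "A_infinity tensor_scale (tensor_algebra scale A) (tensor_component scale A G) tensor_op"
      by (rule A_infinity_tensor_op[OF inj_two_powi])
  qed (use t1 word_op_single t2 t word_op_first_last in \<open>simp_all add: Let_def\<close>)
qed

end
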